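(* Let $(X,r)$ be a finite non-degenerate solution of the Yang--Baxter equation. If the derived solution $(X,r_\triangleright)$ is indecomposable, then $G(X,r)*G(X,r)$ is finite. Moreover, (still assuming that the derived solution is indecomposable) if $G(X,r)\not\cong\mathbb{Z}$, then the multiplicative group of $G(X,r)$ has torsion, i.e. contains a non-trivial element of finite order.
   Context: A solution of the Yang--Baxter equation is a pair $(X,r)$ with $X$ a non-empty set and $r\colon X\times X\to X\times X$ a bijective map with $r_1r_2r_1=r_2r_1r_2$ on $X^3$, where $r_1=r\times\mathrm{id}$, $r_2=\mathrm{id}\times r$. Write $r(x,y)=(\sigma_x(y),\tau_y(x))$. It is non-degenerate if all $\sigma_x$ and $\tau_x$ are bijective, and finite if $X$ is finite. The structure group is $G(X,r)=\langle X\mid xy=\sigma_x(y)\tau_y(x)\text{ for }x,y\in X\rangle$. A skew left brace is a triple $(A,+,\circ)$ with $(A,+)$, $(A,\circ)$ groups such that $a\circ(b+c)=a\circ b-a+a\circ c$; put $\lambda_a(b)=-a+a\circ b$ and $a*b=\lambda_a(b)-b$, and let $A*A$ be the additive subgroup generated by all $a*b$, $a,b\in A$. Each skew left brace $A$ gives a solution $r_A(a,b)=(\lambda_a(b),\lambda_a(b)'\circ a\circ b)$, where $c'$ is the inverse of $c$ in $(A,\circ)$. It is known that for a non-degenerate solution $(X,r)$ there is a unique skew left brace structure on $G(X,r)$, whose multiplicative group $(G(X,r),\circ)$ is the structure group, such that $r_{G(X,r)}(\iota\times\iota)=(\iota\times\iota)r$, where $\iota\colon X\to G(X,r)$ is the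 canonical map; its additive group is isomorphic to $A(X,r)=\langle X\mid x+\sigma_x(y)=\sigma_x(y)+\sigma_{\sigma_x(y)}(\tau_y(x))\text{ for }x,y\in X\rangle$ (with generators corresponding to $\iota(x)$). The derived solution $(X,r_\triangleright)$ of $(X,r)$ is $r_\triangleright(x,y)=(y,y\triangleright x)$, where $y\triangleright x=\sigma_y(\tau_{\sigma_x^{-1}(y)}(x))$. It is indecomposable if the group generated by all permutations $x\mapsto y\triangleright x$ ($y\in X$) of $X$ acts transitively on $X$. *)

theory Defs
  imports "HOL-Algebra.Elementary_Groups" "HOL-Algebra.Bij" "HOL-Algebra.Ring"
begin

section \<open>Groups given by generators and relations\<close>

text \<open>
  A letter \<open>(True, x)\<close> stands for the generator \<open>x\<close>, a letter \<open>(False, x)\<close> for its formal inverse.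
  A relation \<open>p = q\<close> is encoded as the pair of words \<open>(p, q)\<close>.
\<close>

type_synonym 'a word = "(bool \<times> 'a) list"

abbreviation words_over :: "'a set \<Rightarrow> 'a word set"
  where "words_over X \<equiv> lists (UNIV \<times> X)"

inductive word_eq :: "'a set \<Rightarrow> ('a word \<times> 'a word) set \<Rightarrow> 'a word \<Rightarrow> 'a word \<Rightarrow> bool"
  for X :: "'a set" and R :: "('a word \<times> 'a word) set"
where
  refl: "u \<in> words_over X \<Longrightarrow> word_eq X R u u"
| sym: "word_eq X R u v \<Longrightarrow> word_eq X R v u"
| trans: "word_eq X R u v \<Longrightarrow> word_eq X R v w \<Longrightarrow> word_eq X R u w"
| cancel: "u \<in> words_over X \<Longrightarrow> v \<in> words_over X \<Longrightarrow> x \<in> X \<Longrightarrow>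
    word_eq X R (u @ [(b, x), (\<not> b, x)] @ v) (u @ v)"
| rel: "u \<in> words_over X \<Longrightarrow> v \<in> words_over X \<Longrightarrow>
    p \<in> words_over X \<Longrightarrow> q \<in> words_over X \<Longrightarrow> (p, q) \<in> R \<Longrightarrow>
    word_eq X R (u @ p @ v) (u @ q @ v)"

definition word_class :: "'a set \<Rightarrow> ('a word \<times> 'a word) set \<Rightarrow> 'a word \<Rightarrow> 'a word set"
  where "word_class X R u = {v. word_eq X R u v}"

definition presented_group :: "'a set \<Rightarrow> ('a word \<times> 'a word) set \<Rightarrow> 'a word set monoid"
  where "presented_group X R =
    \<lparr>carrier = word_class X R ` words_over X,
     mult = (\<lambda>A B. \<Union>u\<in>A. \<Union>v\<in>B. word_class X R (u @ v)),
     one = word_class X R []\<rparr>"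

lemma word_eq_words:
  assumes "word_eq X R u v"
  shows "u \<in> words_over X \<and> v \<in> words_over X"
  using assms by induction auto

lemma word_eq_append:
  assumes "word_eq X R u u'" and "word_eq X R v v'"
  shows "word_eq X R (u @ v) (u' @ v')"
proof -
  have right: "word_eq X R (s @ t) (s' @ t)"
    if "word_eq X R s s'" and "t \<in> words_over X" for s s' t
    using that
  proof (induction arbitrary: t rule: word_eq.induct)
    case (refl u)
    then have "u @ t \<in> words_over X" by simp
    then show ?case by (rule word_eq.refl)
  next
    case (sym u v)
    then show ?case using word_eq.sym by blast
  next
    case (trans u v w)
    then show ?case using word_eq.trans by blast
  next
    case (cancel u v x b)
    then show ?case using word_eq.cancel[of u X "v @ t" x R b] by simp
  next
    case (rel u v p q)
    then show ?case using word_eq.rel[of u X "v @ t" p q R] by simp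
  qed
  have left: "word_eq X R (t @ s) (t @ s')"
    if "word_eq X R s s'" and "t \<in> words_over X" for s s' t
    using that
  proof (induction arbitrary: t rule: word_eq.induct)
    case (refl u)
    then have "t @ u \<in> words_over X" by simp
    then show ?case by (rule word_eq.refl)
  next
    case (sym u v)
    then show ?case using word_eq.sym by blast
  next
    case (trans u v w)
    then show ?case using word_eq.trans by blast
  next
    case (cancel u v x b)
    then show ?case using word_eq.cancel[of "t @ u" X v x R b] by simp
  next
    case (rel u v p q)
    then show ?case using word_eq.rel[of "t @ u" X v p q R] by simp
  qed
  show ?thesis
  proof (rule word_eq.trans)
    show "word_eq X R (u @ v) (u' @ v)"
      using right[OF assms(1)] word_eq_words[OF assms(2)] by simp
    show "word_eq X R (u' @ v) (u' @ v')"
      using left[OF assms(2)] word_eq_words[OF assms(1)] by simp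
  qed
qed

lemma word_class_eq_iff:
  assumes "u \<in> words_over X"
  shows "word_class X R u = word_class X R v \<longleftrightarrow> word_eq X R u v"
proof
  assume "word_class X R u = word_class X R v"
  then have "word_eq X R v u"
    using word_eq.refl[OF assms, of R] unfolding word_class_def by blast
  then show "word_eq X R u v"
    by (rule word_eq.sym)
next
  assume uv: "word_eq X R u v"
  show "word_class X R u = word_class X R v"
    unfolding word_class_def
    using word_eq.trans[OF uv] word_eq.trans[OF word_eq.sym[OF uv]] by blast
qed

lemma presented_group_mult:
  assumes "u \<in> words_over X" and "v \<in> words_over X"
  shows "word_class X R u \<otimes>\<^bsub>presented_group X R\<^esub> word_class X R v = word_class X R (u @ v)"
proof -
  have eq: "word_class X R (s @ t) = word_class X R (u @ v)"
    if "word_eq X R u s" and "word_eq X R v t" for s t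
  proof -
    have "word_eq X R (s @ t) (u @ v)"
      by (rule word_eq.sym[OF word_eq_append[OF that]])
    then show ?thesis
      using word_class_eq_iff word_eq_words by blast
  qed
  have "u \<in> word_class X R u" "v \<in> word_class X R v"
    using assms by (auto simp: word_class_def intro: word_eq.refl)
  moreover have "word_class X R (s @ t) = word_class X R (u @ v)"
    if "s \<in> word_class X R u" "t \<in> word_class X R v" for s t
    using that eq by (simp add: word_class_def)
  ultimately have "(\<Union>s\<in>word_class X R u. \<Union>t\<in>word_class X R v. word_class X R (s @ t))
    = word_class X R (u @ v)"
    by blast
  then show ?thesis
    by (simp add: presented_group_def)
qed

theorem group_presented_group: "group (presented_group X R)"
proof (rule groupI)
  let ?G = "presented_group X R"
  have carrier: "carrier ?G = word_class X R ` words_over X"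
    and one: "\<one>\<^bsub>?G\<^esub> = word_class X R []"
    by (simp_all add: presented_group_def)
  show "\<one>\<^bsub>?G\<^esub> \<in> carrier ?G"
    by (auto simp: carrier one)
  fix a assume "a \<in> carrier ?G"
  then obtain u where u: "u \<in> words_over X" "a = word_class X R u"
    by (auto simp: carrier)
  show "\<one>\<^bsub>?G\<^esub> \<otimes>\<^bsub>?G\<^esub> a = a"
    using presented_group_mult[of "[]" X u R] u by (simp add: one)
  define inv_word where "inv_word = (\<lambda>w :: 'a word. rev (map (\<lambda>(b, x). (\<not> b, x)) w))"
  have inv_words: "inv_word w \<in> words_over X" if "w \<in> words_over X" for w
    using that by (auto simp: inv_word_def)
  have "word_eq X R (inv_word u @ u) []"
    using u(1)
  proof (induction u rule: list.induct)
    case Nil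
    show ?case by (auto simp: inv_word_def intro: word_eq.refl)
  next
    case (Cons l w)
    obtain b x where l: "l = (b, x)" by (cases l)
    have w: "w \<in> words_over X" and x: "x \<in> X" using Cons.prems by (auto simp: l)
    have "word_eq X R (inv_word w @ [(\<not> b, x), (\<not> \<not> b, x)] @ w) (inv_word w @ w)"
      by (rule word_eq.cancel[OF inv_words[OF w] w x])
    then have "word_eq X R (inv_word (l # w) @ l # w) (inv_word w @ w)"
      by (simp add: inv_word_def l)
    then show ?case using Cons.IH[OF w] word_eq.trans by blast
  qed
  then have "word_class X R (inv_word u) \<otimes>\<^bsub>?G\<^esub> a = \<one>\<^bsub>?G\<^esub>"
    using presented_group_mult[OF inv_words[OF u(1)] u(1)] u
      word_class_eq_iff[of "inv_word u @ u" X R "[]"] inv_words[OF u(1)] by (simp add: one)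
  then show "\<exists>b\<in>carrier ?G. b \<otimes>\<^bsub>?G\<^esub> a = \<one>\<^bsub>?G\<^esub>"
    using inv_words[OF u(1)] by (auto simp: carrier)
  fix b assume "b \<in> carrier ?G"
  then obtain v where v: "v \<in> words_over X" "b = word_class X R v"
    by (auto simp: carrier)
  show "a \<otimes>\<^bsub>?G\<^esub> b \<in> carrier ?G"
    using presented_group_mult[OF u(1) v(1)] u v by (auto simp: carrier)
  fix c assume "c \<in> carrier ?G"
  then obtain w where w: "w \<in> words_over X" "c = word_class X R w"
    by (auto simp: carrier)
  show "a \<otimes>\<^bsub>?G\<^esub> b \<otimes>\<^bsub>?G\<^esub> c = a \<otimes>\<^bsub>?G\<^esub> (b \<otimes>\<^bsub>?G\<^esub> c)"
    using u v w by (simp add: presented_group_mult)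
qed


section \<open>Solutions of the Yang--Baxter equation\<close>

definition sol_sigma :: "('a \<times> 'a \<Rightarrow> 'a \<times> 'a) \<Rightarrow> 'a \<Rightarrow> 'a \<Rightarrow> 'a"
  where "sol_sigma r x y = fst (r (x, y))"

text \<open>Note the order of the arguments: \<open>r (x, y) = (sol_sigma r x y, sol_tau r y x)\<close>.\<close>

definition sol_tau :: "('a \<times> 'a \<Rightarrow> 'a \<times> 'a) \<Rightarrow> 'a \<Rightarrow> 'a \<Rightarrow> 'a"
  where "sol_tau r y x = snd (r (x, y))"

definition r_left :: "('a \<times> 'a \<Rightarrow> 'a \<times> 'a) \<Rightarrow> 'a \<times> 'a \<times> 'a \<Rightarrow> 'a \<times> 'a \<times> 'a"
  where "r_left r = (\<lambda>(x, y, z). case r (x, y) of (u, v) \<Rightarrow> (u, v, z))"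

definition r_right :: "('a \<times> 'a \<Rightarrow> 'a \<times> 'a) \<Rightarrow> 'a \<times> 'a \<times> 'a \<Rightarrow> 'a \<times> 'a \<times> 'a"
  where "r_right r = (\<lambda>(x, y, z). (x, r (y, z)))"

definition ybe_solution :: "'a set \<Rightarrow> ('a \<times> 'a \<Rightarrow> 'a \<times> 'a) \<Rightarrow> bool"
  where "ybe_solution X r \<longleftrightarrow>
    X \<noteq> {} \<and> bij_betw r (X \<times> X) (X \<times> X) \<and>
    (\<forall>t \<in> X \<times> X \<times> X.
      r_left r (r_right r (r_left r t)) = r_right r (r_left r (r_right r t)))"

definition nondegenerate :: "'a set \<Rightarrow> ('a \<times> 'a \<Rightarrow> 'a \<times> 'a) \<Rightarrow> bool"
  where "nondegenerate X r \<longleftrightarrow>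
    (\<forall>x\<in>X. bij_betw (sol_sigma r x) X X \<and> bij_betw (sol_tau r x) X X)"

definition derived_op :: "'a set \<Rightarrow> ('a \<times> 'a \<Rightarrow> 'a \<times> 'a) \<Rightarrow> 'a \<Rightarrow> 'a \<Rightarrow> 'a"
  where "derived_op X r y x =
    sol_sigma r y (sol_tau r (inv_into X (sol_sigma r x) y) x)"

definition derived_solution :: "'a set \<Rightarrow> ('a \<times> 'a \<Rightarrow> 'a \<times> 'a) \<Rightarrow> 'a \<times> 'a \<Rightarrow> 'a \<times> 'a"
  where "derived_solution X r = (\<lambda>(x, y). (y, derived_op X r y x))"

text \<open>
  Indecomposability of a solution \<open>s\<close> of derived type, i.e. \<open>s (x, y) = (y, y \<triangleright> x)\<close>.
  Here \<open>sol_tau s y\<close> is the map \<open>x \<mapsto> y \<triangleright> x\<close>; it is restricted to \<open>X\<close> because the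
  elements of \<open>BijGroup X\<close> are extensional functions.
\<close>

definition derived_type_indecomposable :: "'a set \<Rightarrow> ('a \<times> 'a \<Rightarrow> 'a \<times> 'a) \<Rightarrow> bool"
  where "derived_type_indecomposable X s \<longleftrightarrow>
    (\<forall>x\<in>X. \<forall>z\<in>X.
      \<exists>g \<in> generate (BijGroup X) ((\<lambda>y. restrict (sol_tau s y) X) ` X). g x = z)"

definition structure_relations :: "'a set \<Rightarrow> ('a \<times> 'a \<Rightarrow> 'a \<times> 'a) \<Rightarrow> ('a word \<times> 'a word) set"
  where "structure_relations X r =
    {([(True, x), (True, y)], [(True, sol_sigma r x y), (True, sol_tau r y x)]) | x y.
      x \<in> X \<and> y \<in> X}"

definition structure_group :: "'a set \<Rightarrow> ('a \<times> 'a \<Rightarrow> 'a \<times> 'a) \<Rightarrow> 'a word set monoid"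
  where "structure_group X r = presented_group X (structure_relations X r)"

definition structure_map :: "'a set \<Rightarrow> ('a \<times> 'a \<Rightarrow> 'a \<times> 'a) \<Rightarrow> 'a \<Rightarrow> 'a word set"
  where "structure_map X r x = word_class X (structure_relations X r) [(True, x)]"


section \<open>Skew left braces\<close>

text \<open>
  The record type \<open>ring\<close> is used only for its signature: \<open>\<oplus>\<close>, \<open>\<zero>\<close>, \<open>\<ominus>\<close> belong to the (not
  necessarily commutative) additive group, and \<open>\<otimes>\<close>, \<open>\<one>\<close>, \<open>inv\<close> to the multiplicative group.
\<close>

definition skew_left_brace :: "('a, 'm) ring_scheme \<Rightarrow> bool"
  where "skew_left_brace B \<longleftrightarrow>
    group (add_monoid B) \<and> group B \<and>
    (\<forall>a\<in>carrier B. \<forall>b\<in>carrier B. \<forall>c\<in>carrier B.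
      a \<otimes>\<^bsub>B\<^esub> (b \<oplus>\<^bsub>B\<^esub> c) = ((a \<otimes>\<^bsub>B\<^esub> b) \<ominus>\<^bsub>B\<^esub> a) \<oplus>\<^bsub>B\<^esub> (a \<otimes>\<^bsub>B\<^esub> c))"

definition brace_lambda :: "('a, 'm) ring_scheme \<Rightarrow> 'a \<Rightarrow> 'a \<Rightarrow> 'a"
  where "brace_lambda B a b = (\<ominus>\<^bsub>B\<^esub> a) \<oplus>\<^bsub>B\<^esub> (a \<otimes>\<^bsub>B\<^esub> b)"

definition brace_star :: "('a, 'm) ring_scheme \<Rightarrow> 'a \<Rightarrow> 'a \<Rightarrow> 'a"
  where "brace_star B a b = brace_lambda B a b \<ominus>\<^bsub>B\<^esub> b"

definition brace_star_square :: "('a, 'm) ring_scheme \<Rightarrow> 'a set"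
  where "brace_star_square B =
    generate (add_monoid B) {brace_star B a b | a b. a \<in> carrier B \<and> b \<in> carrier B}"

definition brace_solution :: "('a, 'm) ring_scheme \<Rightarrow> 'a \<times> 'a \<Rightarrow> 'a \<times> 'a"
  where "brace_solution B = (\<lambda>(a, b).
    (brace_lambda B a b, inv\<^bsub>B\<^esub> (brace_lambda B a b) \<otimes>\<^bsub>B\<^esub> a \<otimes>\<^bsub>B\<^esub> b))"

text \<open>
  Skew left brace structures on \<open>G(X,r)\<close> compatible with \<open>r\<close>: the multiplicative group is the
  structure group itself.
\<close>

definition is_structure_brace ::
  "'a set \<Rightarrow> ('a \<times> 'a \<Rightarrow> 'a \<times> 'a) \<Rightarrow> 'a word set ring \<Rightarrow> bool"
  where "is_structure_brace X r B \<longleftrightarrow>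
    skew_left_brace B \<and> monoid.truncate B = structure_group X r \<and>
    (\<forall>x\<in>X. \<forall>y\<in>X.
      brace_solution B (structure_map X r x, structure_map X r y) =
      map_prod (structure_map X r) (structure_map X r) (r (x, y)))"

text \<open>
  For non-degenerate solutions such a structure exists and its addition is uniquely determined on
  the carrier. Since records do not determine \<open>\<oplus>\<close> off the carrier, \<open>SOME\<close> is used instead of
  \<open>THE\<close>; the choice affects only these irrelevant values.
\<close>

definition structure_brace :: "'a set \<Rightarrow> ('a \<times> 'a \<Rightarrow> 'a \<times> 'a) \<Rightarrow> 'a word set ring"
  where "structure_brace X r = (SOME B. is_structure_brace X r B)"


definition has_torsion :: "('a, 'm) monoid_scheme \<Rightarrow> bool"
  where "has_torsion G \<longleftrightarrow>
    (\<exists>g\<in>carrier G. g \<noteq> \<one>\<^bsub>G\<^esub> \<and> (\<exists>n::nat. n > 0 \<and> g [^]\<^bsub>G\<^esub> n = \<one>\<^bsub>G\<^esub>))"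

end

theory Submission
  imports Defs
begin

text \<open>
  The additive group of the skew brace is realised inside the permutations of \<open>G = G(X,r)\<close>. Since
  \<open>a + \<iota> x\<close> has to be \<open>a \<circ> \<iota> (\<lambda>\<^sub>a\<^sup>-\<^sup>1 x)\<close> and \<open>G\<close> acts on \<open>X\<close> by \<open>\<lambda>\<close>, right translation by \<open>\<iota> x\<close> is a map \<open>T\<^sub>x\<close>
  that can be written down directly; left multiplication \<open>L\<^sub>g\<close> conjugates \<open>T\<^sub>x\<close> to \<open>T\<close> with index
  \<open>\<lambda>\<^sub>g x\<close>. The maps \<open>T\<^sub>x\<^sup>-\<^sup>1 L\<^sub>x\<close> satisfy the relations of \<open>G\<close>, so they extend to a homomorphism \<open>\<Theta>\<close>, and
  \<open>\<pi> a = L\<^sub>a \<Theta>\<^sub>a\<^sup>-\<^sup>1\<close> is a bijective cocycle onto the group generated by the \<open>T\<^sub>x\<close>; addition is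
  \<open>a + b = \<pi> b a\<close>.

  If the derived solution is indecomposable, \<open>\<iota> X\<close> is a finite conjugacy class generating the
  additive group, hence all \<open>\<iota> x\<close> have a common central power \<open>z = n \<iota> x\<close>. The degree map to the
  integers is a homomorphism for both operations; as in Dietzmann's lemma every element is a multiple
  of \<open>z\<close> plus a word of bounded length, so the kernel of the degree is finite. It contains \<open>G * G\<close>, and
  it is non-trivial unless the degree is an isomorphism.
\<close>

section \<open>Induction over a generated subgroup, one generator at a time\<close>

lemma (in group) generate_right_induct [consumes 2, case_names one mult mult_inv]:
  assumes "a \<in> generate G S" and S: "S \<subseteq> carrier G"
    and "P \<one>"
    and mult: "\<And>a s. a \<in> generate G S \<Longrightarrow> s \<in> S \<Longrightarrow> P a \<Longrightarrow> P (a \<otimes> s)"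
    and mult_inv: "\<And>a s. a \<in> generate G S \<Longrightarrow> s \<in> S \<Longrightarrow> P a \<Longrightarrow> P (a \<otimes> inv s)"
  shows "P a"
proof -
  \<comment> \<open>The left factor \<open>b\<close> is arbitrary because the product rule of
    \<open>generate\<close> joins two generated elements: the first leads from \<open>b\<close> to
    \<open>b \<otimes> h1\<close>, the second continues from there.\<close>
  have "P (b \<otimes> a)" if "b \<in> generate G S" "P b" for b
    using assms(1) that
  proof (induction arbitrary: b)
    case one
    then show ?case using generate_in_carrier[OF S] by simp
  next
    case (incl h)
    then show ?case by (rule_tac mult)
  next
    case (inv h)
    then show ?case by (rule_tac mult_inv)
  next
    case (eng h1 h2)
    have "P ((b \<otimes> h1) \<otimes> h2)"
      by (meson eng generate.eng)
    then show ?case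
      using eng generate_in_carrier[OF S] by (simp add: m_assoc)
  qed
  then have "P (\<one> \<otimes> a)"
    using generate.one assms(3) by blast
  then show ?thesis
    using generate_in_carrier[OF S assms(1)] by simp
qed

section \<open>Presented groups\<close>

definition word_eval :: "('b, 'm) monoid_scheme \<Rightarrow> ('a \<Rightarrow> 'b) \<Rightarrow> 'a word \<Rightarrow> 'b"
  where "word_eval H f w =
    foldr (\<lambda>(b, x) g. (if b then f x else inv\<^bsub>H\<^esub> (f x)) \<otimes>\<^bsub>H\<^esub> g) w \<one>\<^bsub>H\<^esub>"

context group
begin

lemma word_eval_Nil [simp]: "word_eval G f [] = \<one>"
  by (simp add: word_eval_def)

lemma word_eval_Cons [simp]:
  "word_eval G f ((b, x) # w) = (if b then f x else inv (f x)) \<otimes> word_eval G f w"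
  by (simp add: word_eval_def)

lemma word_eval_closed:
  assumes "f \<in> X \<rightarrow> carrier G" and "w \<in> words_over X"
  shows "word_eval G f w \<in> carrier G"
  using assms(2,1) by (induction w rule: lists.induct) (auto simp: Pi_iff)

lemma word_eval_append:
  assumes f: "f \<in> X \<rightarrow> carrier G" and "u \<in> words_over X" and v: "v \<in> words_over X"
  shows "word_eval G f (u @ v) = word_eval G f u \<otimes> word_eval G f v"
  using assms(2)
proof (induction u rule: lists.induct)
  case Nil
  then show ?case using word_eval_closed[OF f v] by simp
next
  case (Cons l u)
  then show ?case
    using f word_eval_closed[OF f] v by (cases l) (auto simp: m_assoc Pi_iff)
qed

lemma word_eval_eq:
  assumes f: "f \<in> X \<rightarrow> carrier G"
    and R: "\<And>p q. (p, q) \<in> R \<Longrightarrow> p \<in> words_over X \<Longrightarrow> q \<in> words_over X \<Longrightarrow>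
      word_eval G f p = word_eval G f q"
    and "word_eq X R u v"
  shows "word_eval G f u = word_eval G f v"
  using assms(3)
proof induction
  case (cancel u v x b)
  have x: "f x \<in> carrier G" using f cancel by auto
  have "word_eval G f ([(b, x), (\<not> b, x)] @ v) = word_eval G f v"
    using x word_eval_closed[OF f \<open>v \<in> words_over X\<close>] by (simp add: m_assoc[symmetric])
  then show ?case
    using cancel word_eval_append[OF f] by (simp del: word_eval_Cons)
next
  case (rel u v p q)
  then show ?case
    using R word_eval_append[OF f] by simp
qed auto

text \<open>Von Dyck's theorem: cancellation and the relations leave the value of a word unchanged,
  so evaluation descends to classes of words.\<close>

lemma presented_group_universal:
  assumes f: "f \<in> X \<rightarrow> carrier G"
    and R: "\<And>p q. (p, q) \<in> R \<Longrightarrow> p \<in> words_over X \<Longrightarrow> q \<in> words_over X \<Longrightarrow>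
      word_eval G f p = word_eval G f q"
  shows "\<exists>h \<in> hom (presented_group X R) G. \<forall>x\<in>X. h (word_class X R [(True, x)]) = f x"
proof -
  \<comment> \<open>An element is itself a set of words. Any member may be evaluated, since by
    \<open>word_eval_eq\<close> the value does not depend on the choice.\<close>
  define h where "h A = word_eval G f (SOME u. u \<in> A)" for A
  have h: "h (word_class X R u) = word_eval G f u" if "u \<in> words_over X" for u
  proof -
    have "u \<in> word_class X R u"
      using that by (simp add: word_class_def word_eq.refl)
    then have "word_eq X R u (SOME v. v \<in> word_class X R u)"
      using someI[of "\<lambda>v. v \<in> word_class X R u"] by (simp add: word_class_def)
    then show ?thesis
      using word_eval_eq[OF f R] unfolding h_def by metis
  qed
  have "h \<in> hom (presented_group X R) G"
  proof (rule homI)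
    fix a assume "a \<in> carrier (presented_group X R)"
    then obtain u where u: "u \<in> words_over X" "a = word_class X R u"
      by (auto simp: presented_group_def)
    then show "h a \<in> carrier G"
      using h word_eval_closed[OF f] by simp
    fix b assume "b \<in> carrier (presented_group X R)"
    then obtain v where v: "v \<in> words_over X" "b = word_class X R v"
      by (auto simp: presented_group_def)
    show "h (a \<otimes>\<^bsub>presented_group X R\<^esub> b) = h a \<otimes> h b"
      using u v h word_eval_append[OF f] by (simp add: presented_group_mult)
  qed
  moreover have "h (word_class X R [(True, x)]) = f x" if "x \<in> X" for x
    using h[of "[(True, x)]"] that f by (auto simp: Pi_iff)
  ultimately show ?thesis by blast
qed

end

lemma inv_word_class:
  assumes "x \<in> X"
  shows "inv\<^bsub>presented_group X R\<^esub> (word_class X R [(True, x)]) = word_class X R [(False, x)]"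
proof (rule group.inv_equality[OF group_presented_group])
  have "word_eq X R ([] @ [(False, x), (\<not> False, x)] @ []) ([] @ [])"
    using assms by (intro word_eq.cancel) auto
  then show "word_class X R [(False, x)] \<otimes>\<^bsub>presented_group X R\<^esub> word_class X R [(True, x)]
      = \<one>\<^bsub>presented_group X R\<^esub>"
    using assms by (simp add: presented_group_mult word_class_eq_iff)
      (simp add: presented_group_def word_class_eq_iff)
qed (use assms in \<open>auto simp: presented_group_def\<close>)

lemma presented_group_generate:
  "carrier (presented_group X R) =
    generate (presented_group X R) ((\<lambda>x. word_class X R [(True, x)]) ` X)"
  (is "?C = generate ?G ?S")
proof
  have S: "?S \<subseteq> ?C"
    by (auto simp: presented_group_def)
  show "generate ?G ?S \<subseteq> ?C"
    using group.generate_in_carrier[OF group_presented_group S] by blast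
  have "word_class X R w \<in> generate ?G ?S" if "w \<in> words_over X" for w
    using that
  proof (induction w rule: lists.induct)
    case Nil
    show ?case using generate.one[of ?G ?S] by (simp add: presented_group_def)
  next
    case (Cons l w)
    obtain b x where l: "l = (b, x)" "x \<in> X" using Cons by (cases l) auto
    have "word_class X R [l] \<in> generate ?G ?S"
      using generate.incl[of _ ?S ?G] generate.inv[of _ ?S ?G] inv_word_class[OF l(2), of R] l
      by (cases b) force+
    then have "word_class X R [l] \<otimes>\<^bsub>?G\<^esub> word_class X R w \<in> generate ?G ?S"
      using Cons generate.eng by metis
    then show ?case
      using Cons l by (simp add: presented_group_mult)
  qed
  then show "?C \<subseteq> generate ?G ?S"
    by (auto simp: presented_group_def)
qed

section \<open>Groups generated by a finite conjugacy class\<close>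

context group
begin

lemma inv_cancel_simps [simp]:
  "g \<in> carrier G \<Longrightarrow> x \<in> carrier G \<Longrightarrow> g \<otimes> (inv g \<otimes> x) = x"
  "g \<in> carrier G \<Longrightarrow> x \<in> carrier G \<Longrightarrow> inv g \<otimes> (g \<otimes> x) = x"
  by (simp_all add: m_assoc[symmetric])

definition list_mult :: "'a list \<Rightarrow> 'a"
  where "list_mult ws = foldr (\<otimes>) ws \<one>"

lemma list_mult_simps [simp]:
  "list_mult [] = \<one>" "list_mult (e # ws) = e \<otimes> list_mult ws"
  by (simp_all add: list_mult_def)

lemma list_mult_closed [simp]: "ws \<in> lists (carrier G) \<Longrightarrow> list_mult ws \<in> carrier G"
  by (induction ws) auto

lemma list_mult_append:
  "us \<in> lists (carrier G) \<Longrightarrow> vs \<in> lists (carrier G) \<Longrightarrow>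
    list_mult (us @ vs) = list_mult us \<otimes> list_mult vs"
  by (induction us) (auto simp: m_assoc)

lemma list_mult_replicate: "e \<in> carrier G \<Longrightarrow> list_mult (replicate n e) = e [^] n"
  by (induction n) (auto simp: nat_pow_Suc2[symmetric] simp del: nat_pow_Suc)

lemma conj_pow:
  assumes "e \<in> carrier G" "g \<in> carrier G"
  shows "inv g \<otimes> e [^] (n::nat) \<otimes> g = (inv g \<otimes> e \<otimes> g) [^] n"
proof (induction n)
  case (Suc n)
  have "inv g \<otimes> e [^] Suc n \<otimes> g = (inv g \<otimes> e [^] n \<otimes> g) \<otimes> (inv g \<otimes> e \<otimes> g)"
    using assms by (simp add: m_assoc)
  then show ?case using Suc by simp
qed (use assms in simp)

lemma conj_power_mem:
  assumes E: "E \<subseteq> carrier G" and conj: "\<And>e f. e \<in> E \<Longrightarrow> f \<in> E \<Longrightarrow> inv e \<otimes> f \<otimes> e \<in> E"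
    and "e \<in> E" "f \<in> E"
  shows "inv (e [^] (n::nat)) \<otimes> f \<otimes> e [^] n \<in> E"
proof (induction n)
  case (Suc n)
  have [simp]: "e \<in> carrier G" "f \<in> carrier G" using assms by auto
  have "inv (e [^] Suc n) \<otimes> f \<otimes> e [^] Suc n = inv e \<otimes> (inv (e [^] n) \<otimes> f \<otimes> e [^] n) \<otimes> e"
    by (simp add: inv_mult_group m_assoc)
  then show ?case using conj[OF \<open>e \<in> E\<close> Suc] by simp
qed (use assms in auto)

text \<open>The collection step of Dietzmann's lemma: pulling \<open>e [^] n\<close> to the front
  past a letter replaces that letter by a conjugate, again in \<open>E\<close>, so the remaining
  word is shorter by exactly \<open>n\<close> letters.\<close>

lemma list_mult_collect:
  assumes E: "E \<subseteq> carrier G" and conj: "\<And>e f. e \<in> E \<Longrightarrow> f \<in> E \<Longrightarrow> inv e \<otimes> f \<otimes> e \<in> E"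
    and e: "e \<in> E" and "ws \<in> lists E" and "n \<le> count_list ws e"
  shows "\<exists>us \<in> lists E. length us + n = length ws \<and> list_mult ws = e [^] n \<otimes> list_mult us"
  using assms(4,5)
proof (induction ws arbitrary: n)
  case Nil
  then show ?case by auto
next
  case (Cons a ws)
  have [simp]: "e \<in> carrier G" "a \<in> carrier G" "a \<in> E" and ws: "ws \<in> lists E"
    using Cons.hyps Cons.prems e E by auto
  have EC: "lists E \<subseteq> lists (carrier G)" using E by (rule lists_mono)
  show ?case
  proof (cases "n = 0")
    case True
    have "list_mult ws \<in> carrier G" using ws EC list_mult_closed by blast
    then show ?thesis using True ws by (intro bexI[of _ "a # ws"]) auto
  next
    case False
    show ?thesis
    proof (cases "a = e")
      case True
      then obtain us where us: "us \<in> lists E" "length us + (n - 1) = length ws"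
        "list_mult ws = e [^] (n - 1) \<otimes> list_mult us"
        using Cons.IH[of "n - 1"] Cons.prems by (auto simp: le_diff_conv)
      have [simp]: "list_mult us \<in> carrier G" using us EC list_mult_closed by blast
      have "list_mult (a # ws) = e [^] Suc (n - 1) \<otimes> list_mult us"
        using us True by (simp add: m_assoc[symmetric] nat_pow_Suc2[symmetric] del: nat_pow_Suc)
      then show ?thesis using us False by (intro bexI[of _ us]) auto
    next
      case ne: False
      then obtain us where us: "us \<in> lists E" "length us + n = length ws"
        "list_mult ws = e [^] n \<otimes> list_mult us"
        using Cons.IH[of n] Cons.prems by auto
      have [simp]: "list_mult us \<in> carrier G" using us EC list_mult_closed by blast
      let ?a = "inv (e [^] n) \<otimes> a \<otimes> e [^] n"
      have "?a \<in> E"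
        using conj_power_mem[OF E conj e] by simp
      moreover have "list_mult (a # ws) = e [^] n \<otimes> list_mult (?a # us)"
        using us by (simp add: m_assoc inv_solve_left)
      ultimately show ?thesis
        using us by (intro bexI[of _ "?a # us"]) auto
    qed
  qed
qed

text \<open>Pigeonhole: the length is the sum of the multiplicities, so it cannot exceed
  \<open>card E * n\<close> if every letter occurs fewer than \<open>n\<close> times.\<close>

lemma exists_frequent_letter:
  assumes "finite E" and "ws \<in> lists E" and "card E * n < length ws"
  shows "\<exists>e\<in>E. n \<le> count_list ws e"
proof (rule ccontr)
  assume neg: "\<not> ?thesis"
  have "set ws \<subseteq> E" using assms(2) by auto
  then have "length ws = (\<Sum>e\<in>E. count_list ws e)"
    using sum_count_set[of ws E] assms(1) by simp
  also have "\<dots> \<le> (\<Sum>e\<in>E. n)"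
    using neg by (intro sum_mono) (auto simp: not_le less_imp_le)
  finally show False using assms(3) by simp
qed

lemma commutes_with_generators:
  assumes "carrier G = generate G E" and E: "E \<subseteq> carrier G" and z: "z \<in> carrier G"
    and comm: "\<And>e. e \<in> E \<Longrightarrow> z \<otimes> e = e \<otimes> z" and "g \<in> carrier G"
  shows "z \<otimes> g = g \<otimes> z"
proof -
  have "g \<in> generate G E" using assms by simp
  then show ?thesis using E
  proof (induction rule: generate_right_induct)
    case one
    then show ?case using z by simp
  next
    case (mult a s)
    then have "a \<in> carrier G" "s \<in> carrier G" using generate_in_carrier[OF E] E by auto
    then show ?case using mult comm z by (metis m_assoc)
  next
    case (mult_inv a s)
    then have [simp]: "a \<in> carrier G" "s \<in> carrier G" using generate_in_carrier[OF E] E by auto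
    have "z \<otimes> inv s = inv s \<otimes> z"
      using comm[OF \<open>s \<in> E\<close>] z
      by (metis \<open>s \<in> carrier G\<close> inv_closed inv_solve_left inv_solve_right m_assoc m_closed)
    then show ?case using mult_inv z by (metis \<open>a \<in> carrier G\<close> \<open>s \<in> carrier G\<close> inv_closed m_assoc)
  qed
qed

text \<open>Conjugation by the powers of \<open>e\<close> acts on the finite set \<open>E\<close>,
  so two powers act alike and their quotient centralises \<open>E\<close>, hence the group. A
  conjugate of a central element is the element itself, so all members of \<open>E\<close> share
  this power.\<close>

lemma conj_class_central_power:
  assumes fin: "finite E" and E: "E \<subseteq> carrier G" and gen: "carrier G = generate G E"
    and conj: "\<And>e f. e \<in> E \<Longrightarrow> f \<in> E \<Longrightarrow> inv e \<otimes> f \<otimes> e \<in> E"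
    and trans: "\<And>e f. e \<in> E \<Longrightarrow> f \<in> E \<Longrightarrow> \<exists>g\<in>carrier G. f = inv g \<otimes> e \<otimes> g"
  shows "\<exists>n>0. \<exists>z\<in>carrier G. (\<forall>e\<in>E. e [^] (n::nat) = z) \<and> (\<forall>g\<in>carrier G. z \<otimes> g = g \<otimes> z)"
proof (cases "E = {}")
  case True
  then show ?thesis by (intro exI[of _ 1] conjI bexI[of _ \<one>]) auto
next
  case False
  then obtain e where e: "e \<in> E" by blast
  then have [simp]: "e \<in> carrier G" using E by auto
  \<comment> \<open>Restriction to \<open>E\<close> places these maps among the finitely many
    extensional functions from \<open>E\<close> to \<open>E\<close>.\<close>
  let ?c = "\<lambda>n::nat. restrict (\<lambda>f. inv (e [^] n) \<otimes> f \<otimes> e [^] n) E"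
  have "range ?c \<subseteq> E \<rightarrow>\<^sub>E E"
    using conj_power_mem[OF E conj e] by auto
  then have "finite (range ?c)"
    using finite_PiE[of E "\<lambda>_. E"] fin finite_subset by blast
  then have "\<not> inj ?c"
    using finite_imageD by blast
  then obtain i j :: nat where ij: "i < j" "?c i = ?c j"
    by (metis (no_types, lifting) injI linorder_neqE_nat)
  define n where "n = j - i"
  have comm: "e [^] n \<otimes> f = f \<otimes> e [^] n" if f: "f \<in> E" for f
  proof -
    have [simp]: "f \<in> carrier G" using f E by auto
    have "inv (e [^] i) \<otimes> f \<otimes> e [^] i = inv (e [^] j) \<otimes> f \<otimes> e [^] j"
      using fun_cong[OF ij(2), of f] f by simp
    moreover have "e [^] j = e [^] n \<otimes> e [^] i"
      using ij by (simp add: n_def nat_pow_mult)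
    ultimately have "inv (e [^] i) \<otimes> (f \<otimes> e [^] i) =
        inv (e [^] i) \<otimes> (inv (e [^] n) \<otimes> f \<otimes> e [^] n \<otimes> e [^] i)"
      by (simp add: inv_mult_group m_assoc)
    then have "f = inv (e [^] n) \<otimes> f \<otimes> e [^] n"
      by simp
    then show ?thesis
      by (metis \<open>e \<in> carrier G\<close> \<open>f \<in> carrier G\<close> inv_closed inv_solve_left m_assoc m_closed nat_pow_closed)
  qed
  have central: "e [^] n \<otimes> g = g \<otimes> e [^] n" if "g \<in> carrier G" for g
    using commutes_with_generators[OF gen E _ comm that] by simp
  have "f [^] n = e [^] n" if "f \<in> E" for f
  proof -
    obtain g where g: "g \<in> carrier G" "f = inv g \<otimes> e \<otimes> g"
      using trans[OF e \<open>f \<in> E\<close>] by blast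
    then have "f [^] n = inv g \<otimes> (e [^] n \<otimes> g)"
      using conj_pow[of e g n] by (simp add: m_assoc)
    then show ?thesis
      using central[OF g(1)] g by (simp add: m_assoc[symmetric])
  qed
  moreover have "n > 0" using ij by (simp add: n_def)
  ultimately show ?thesis
    using central by (intro exI[of _ n] conjI bexI[of _ "e [^] n"]) auto
qed

text \<open>
  A word with more than \<open>|E| n\<close> letters contains some \<open>e\<close> at least \<open>n\<close>
  times, and \<open>e\<^sup>n = z\<close> can be split off. A bounded word of degree \<open>d\<close> represents an element of the
  kernel only together with the power \<open>z\<^sup>k\<close> with \<open>k n = - d\<close>.
\<close>

theorem finite_kernel_degree:
  assumes fin: "finite E" and E: "E \<subseteq> carrier G" and gen: "carrier G = generate G E"
    and conj: "\<And>e f. e \<in> E \<Longrightarrow> f \<in> E \<Longrightarrow> inv e \<otimes> f \<otimes> e \<in> E"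
    and trans: "\<And>e f. e \<in> E \<Longrightarrow> f \<in> E \<Longrightarrow> \<exists>g\<in>carrier G. f = inv g \<otimes> e \<otimes> g"
    and deg: "deg \<in> hom G integer_group" and deg1: "\<And>e. e \<in> E \<Longrightarrow> deg e = 1"
  shows "finite {g \<in> carrier G. deg g = 0}"
proof -
  obtain n z where n: "n > 0" and z: "z \<in> carrier G" "\<And>e. e \<in> E \<Longrightarrow> e [^] (n::nat) = z"
    and central: "\<And>g. g \<in> carrier G \<Longrightarrow> z \<otimes> g = g \<otimes> z"
    using conj_class_central_power[OF fin E gen conj trans] by metis
  have EC: "lists E \<subseteq> lists (carrier G)" using E by (rule lists_mono)
  have LC: "list_mult ws \<in> carrier G" if "ws \<in> lists E" for ws
    using that EC list_mult_closed by blast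
  have LA: "list_mult (us @ vs) = list_mult us \<otimes> list_mult vs" if "us \<in> lists E" "vs \<in> lists E" for us vs
    using that EC list_mult_append by blast
  have word: "\<exists>k::int. \<exists>ws\<in>lists E. g = z [^] k \<otimes> list_mult ws" if "g \<in> carrier G" for g
  proof -
    have "g \<in> generate G E" using that gen by simp
    then show ?thesis using E
    proof (induction rule: generate_right_induct)
      case one
      show ?case using z by (intro exI[of _ "0::int"] bexI[of _ "[]"]) auto
    next
      case (mult a e)
      then obtain k :: int and ws where ws: "ws \<in> lists E" and a: "a = z [^] k \<otimes> list_mult ws"
        by blast
      have e: "e \<in> carrier G" using mult E by auto
      have "a \<otimes> e = z [^] k \<otimes> list_mult (ws @ [e])"
        using LA[of ws "[e]"] ws a e mult(2) z(1) LC[OF ws] by (simp add: m_assoc)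
      then show ?case using ws mult by (intro exI[of _ k] bexI[of _ "ws @ [e]"]) auto
    next
      case (mult_inv a e)
      then obtain k :: int and ws where ws: "ws \<in> lists E" and a: "a = z [^] k \<otimes> list_mult ws"
        by blast
      \<comment> \<open>As \<open>z = e [^] n\<close>, the inverse of \<open>e\<close> is
        \<open>inv z \<otimes> e [^] (n - 1)\<close>: an inverse letter is traded for
        \<open>n - 1\<close> positive ones and a lower exponent of \<open>z\<close>.\<close>
      let ?us = "ws @ replicate (n - 1) e"
      have e: "e \<in> carrier G" using mult_inv E by auto
      have ez: "z = e [^] (n - 1) \<otimes> e"
        using z(2)[OF mult_inv(2)] n by (metis Suc_pred' nat_pow_Suc)
      have us: "?us \<in> lists E" using ws mult_inv by (auto simp: in_lists_conv_set)
      have "z [^] (k - 1) \<otimes> list_mult ?us \<otimes> e = z [^] (k - 1) \<otimes> list_mult ws \<otimes> z"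
        using LA[OF ws, of "replicate (n - 1) e"] us z(1) LC[OF ws] e ez
        by (simp add: m_assoc list_mult_replicate)
      also have "\<dots> = (z [^] (k - 1) \<otimes> z) \<otimes> list_mult ws"
        using z(1) LC[OF ws] central[OF LC[OF ws]] by (simp add: m_assoc)
      also have "z [^] (k - 1) \<otimes> z = z [^] k"
        using z(1) int_pow_mult[of z "k - 1" 1] by simp
      finally have "a \<otimes> inv e = z [^] (k - 1) \<otimes> list_mult ?us"
        using a z(1) LC[OF us] LC[OF ws] e by (simp add: inv_solve_right')
      then show ?case using us by blast
    qed
  qed
  define N where "N = card E * n"
  have short: "\<exists>k::int. \<exists>us\<in>lists E. length us \<le> N \<and> z [^] k' \<otimes> list_mult ws = z [^] k \<otimes> list_mult us"
    if "ws \<in> lists E" for ws and k' :: int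
    using that
  proof (induction "length ws" arbitrary: ws k' rule: less_induct)
    case less
    show ?case
    proof (cases "length ws \<le> N")
      case True
      then show ?thesis using less by blast
    next
      case False
      then obtain e where e: "e \<in> E" "n \<le> count_list ws e"
        using exists_frequent_letter[OF fin less.prems, of n] by (auto simp: N_def)
      then obtain us where us: "us \<in> lists E" "length us + n = length ws"
        "list_mult ws = z \<otimes> list_mult us"
        using list_mult_collect[OF E conj e(1) less.prems e(2)] z(2) by auto
      have "z [^] k' \<otimes> list_mult ws = z [^] (k' + 1) \<otimes> list_mult us"
        using us z(1) LC[OF us(1)] int_pow_mult[of z k' 1] by (simp add: m_assoc)
      then show ?thesis
        using less.hyps[of us "k' + 1"] us n by auto
    qed
  qed
  have deg_list: "deg (list_mult ws) = int (length ws)" if "ws \<in> lists E" for ws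
    using that
  proof (induction ws)
    case Nil
    then show ?case using hom_one[OF deg] by simp
  next
    case (Cons e ws)
    then show ?case using hom_mult[OF deg, of e "list_mult ws"] E LC[of ws] deg1 by auto
  qed
  have deg_pow: "deg (g [^] k) = k * deg g" if "g \<in> carrier G" for g and k :: int
    using hom_int_pow[OF deg that is_group group_integer_group, of k] by simp
  have "{g \<in> carrier G. deg g = 0} \<subseteq>
    (\<lambda>us. z [^] (- (int (length us) div int n)) \<otimes> list_mult us) ` {us \<in> lists E. length us \<le> N}"
  proof clarify
    fix g assume g: "g \<in> carrier G" "deg g = 0"
    obtain k :: int and us where us: "us \<in> lists E" "length us \<le> N" "g = z [^] k \<otimes> list_mult us"
      using word[OF g(1)] short by metis
    show "g \<in> (\<lambda>us. z [^] (- (int (length us) div int n)) \<otimes> list_mult us) `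
        {us \<in> lists E. length us \<le> N}"
    proof (cases "E = {}")
      \<comment> \<open>Without generators the group is trivial; in the other case a member of
        \<open>E\<close> yields \<open>deg z = n\<close>.\<close>
      case True
      then show ?thesis using us gen g by (auto simp: generate_empty)
    next
      case False
      then obtain e where e: "e \<in> E" by blast
      have "deg z = int n"
        using z(2)[OF e] deg1[OF e] e E deg_pow[of e "int n"] by (auto simp: int_pow_int)
      then have "0 = k * int n + int (length us)"
        using g(2) us(1,3) z(1) hom_mult[OF deg, of "z [^] k" "list_mult us"] LC[OF us(1)]
          deg_list deg_pow[OF z(1)] by simp
      then have "int (length us) = (- k) * int n" by simp
      then have "int (length us) div int n = - k" using n by (metis nonzero_mult_div_cancel_right of_nat_0_less_iff less_irrefl)
      then have "k = - (int (length us) div int n)" by simp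
      then show ?thesis using us by blast
    qed
  qed
  moreover have "finite {us \<in> lists E. length us \<le> N}"
    using finite_lists_length_le[OF fin, of N] by (rule rev_finite_subset) auto
  ultimately show ?thesis
    using finite_surj by blast
qed

end

section \<open>Permutation groups\<close>

lemma carrier_BijGroup: "carrier (BijGroup S) = Bij S"
  by (simp add: BijGroup_def)

lemma BijGroup_mult_apply:
  "f \<in> Bij S \<Longrightarrow> g \<in> Bij S \<Longrightarrow> x \<in> S \<Longrightarrow> (f \<otimes>\<^bsub>BijGroup S\<^esub> g) x = f (g x)"
  by (simp add: BijGroup_def compose_def)

lemma BijGroup_one_apply: "x \<in> S \<Longrightarrow> \<one>\<^bsub>BijGroup S\<^esub> x = x"
  by (simp add: BijGroup_def)

lemma BijGroup_mult_Bij: "f \<in> Bij S \<Longrightarrow> g \<in> Bij S \<Longrightarrow> f \<otimes>\<^bsub>BijGroup S\<^esub> g \<in> Bij S"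
  by (simp add: BijGroup_def compose_Bij)

lemma Bij_eqI: "f \<in> Bij S \<Longrightarrow> g \<in> Bij S \<Longrightarrow> (\<And>x. x \<in> S \<Longrightarrow> f x = g x) \<Longrightarrow> f = g"
  by (meson Bij_imp_extensional extensionalityI)

lemma restrict_Bij: "bij_betw f S S \<Longrightarrow> restrict f S \<in> Bij S"
  by (simp add: Bij_def cong: bij_betw_cong)

lemma Bij_closed: "f \<in> Bij S \<Longrightarrow> x \<in> S \<Longrightarrow> f x \<in> S"
  using Bij_imp_funcset by blast

section \<open>Solutions of the Yang--Baxter equation\<close>

locale finite_nondegenerate_solution =
  fixes X :: "'a set" and r :: "'a \<times> 'a \<Rightarrow> 'a \<times> 'a"
  assumes ybe: "ybe_solution X r" and fin: "finite X" and nondeg: "nondegenerate X r"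
begin

abbreviation \<sigma> where "\<sigma> \<equiv> sol_sigma r"
abbreviation \<tau> where "\<tau> \<equiv> sol_tau r"
abbreviation D where "D \<equiv> derived_op X r"

lemma r_eq: "r (x, y) = (\<sigma> x y, \<tau> y x)"
  by (simp add: sol_sigma_def sol_tau_def)

lemma sigma_bij: "x \<in> X \<Longrightarrow> bij_betw (\<sigma> x) X X"
  and tau_bij: "x \<in> X \<Longrightarrow> bij_betw (\<tau> x) X X"
  using nondeg by (auto simp: nondegenerate_def)

lemma sigma_closed [simp]: "x \<in> X \<Longrightarrow> y \<in> X \<Longrightarrow> \<sigma> x y \<in> X"
  and tau_closed [simp]: "x \<in> X \<Longrightarrow> y \<in> X \<Longrightarrow> \<tau> x y \<in> X"
  using sigma_bij tau_bij bij_betwE by metis+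

lemma r_inj: "x \<in> X \<Longrightarrow> y \<in> X \<Longrightarrow> x' \<in> X \<Longrightarrow> y' \<in> X \<Longrightarrow> r (x, y) = r (x', y') \<Longrightarrow> x = x' \<and> y = y'"
  using ybe by (auto simp: ybe_solution_def bij_betw_def inj_on_def)

text \<open>The first two coordinates of the braid relation at \<open>(x, y, z)\<close>.\<close>

lemma
  assumes "x \<in> X" "y \<in> X" "z \<in> X"
  shows sigma_sigma: "\<sigma> x (\<sigma> y z) = \<sigma> (\<sigma> x y) (\<sigma> (\<tau> y x) z)"
    and tau_sigma: "\<tau> (\<sigma> (\<tau> y x) z) (\<sigma> x y) = \<sigma> (\<tau> (\<sigma> y z) x) (\<tau> z y)"
proof -
  have "r_left r (r_right r (r_left r (x, y, z))) = r_right r (r_left r (r_right r (x, y, z)))"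
    using ybe assms by (auto simp: ybe_solution_def)
  then show "\<sigma> x (\<sigma> y z) = \<sigma> (\<sigma> x y) (\<sigma> (\<tau> y x) z)"
    and "\<tau> (\<sigma> (\<tau> y x) z) (\<sigma> x y) = \<sigma> (\<tau> (\<sigma> y z) x) (\<tau> z y)"
    by (simp_all add: r_left_def r_right_def r_eq)
qed

text \<open>Writing the first argument as \<open>\<sigma> x y\<close> removes the inverse of
  \<open>\<sigma> x\<close> from the definition; \<open>sigma_surjE\<close> brings any
  \<open>u\<close> into this form.\<close>

lemma derived_sigma:
  assumes "x \<in> X" "y \<in> X"
  shows "D (\<sigma> x y) x = \<sigma> (\<sigma> x y) (\<tau> y x)"
  using assms sigma_bij[of x] by (simp add: derived_op_def bij_betw_def inv_into_f_f)

lemma sigma_surjE: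
  assumes "x \<in> X" "u \<in> X"
  obtains y where "y \<in> X" "u = \<sigma> x y"
proof -
  have "u \<in> \<sigma> x ` X" using assms bij_betw_imp_surj_on[OF sigma_bij] by simp
  then show ?thesis using that by blast
qed

lemma sigma_inj: "x \<in> X \<Longrightarrow> y \<in> X \<Longrightarrow> z \<in> X \<Longrightarrow> \<sigma> x y = \<sigma> x z \<longleftrightarrow> y = z"
  and tau_inj: "x \<in> X \<Longrightarrow> y \<in> X \<Longrightarrow> z \<in> X \<Longrightarrow> \<tau> x y = \<tau> x z \<longleftrightarrow> y = z"
  using inj_on_eq_iff[OF bij_betw_imp_inj_on[OF sigma_bij]]
    inj_on_eq_iff[OF bij_betw_imp_inj_on[OF tau_bij]] by blast+

lemma derived_closed [simp]:
  assumes "u \<in> X" "x \<in> X"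
  shows "D u x \<in> X"
proof -
  obtain y where "y \<in> X" "u = \<sigma> x y" using sigma_surjE assms by blast
  then show ?thesis using derived_sigma[of x y] assms by simp
qed

text \<open>For \<open>u = \<sigma> x y\<close>, the values \<open>u\<close> and
  \<open>D u x\<close> determine both coordinates of \<open>r (x, y)\<close>, hence
  \<open>x\<close>, because \<open>r\<close> is injective. Finiteness of \<open>X\<close> supplies
  surjectivity.\<close>

lemma derived_bij:
  assumes u: "u \<in> X"
  shows "bij_betw (D u) X X"
proof -
  have "inj_on (D u) X"
  proof (rule inj_onI)
    fix x x' assume x: "x \<in> X" "x' \<in> X" and eq: "D u x = D u x'"
    obtain y where y: "y \<in> X" "u = \<sigma> x y" using sigma_surjE x u by blast
    obtain y' where y': "y' \<in> X" "u = \<sigma> x' y'" using sigma_surjE x u by blast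
    have "\<tau> y x = \<tau> y' x'"
      using eq x y y' u derived_sigma[of x y] derived_sigma[of x' y']
        sigma_inj[of u "\<tau> y x" "\<tau> y' x'"] by simp
    then have "r (x, y) = r (x', y')"
      using y y' by (simp add: r_eq)
    then show "x = x'" using r_inj[of x y x' y'] x y y' by simp
  qed
  moreover have "D u ` X \<subseteq> X" using u by auto
  ultimately show ?thesis
    using fin by (simp add: bij_betw_def endo_inj_surj)
qed

text \<open>With \<open>u = \<sigma> x y\<close>, the identities \<open>sigma_sigma\<close> and
  \<open>tau_sigma\<close> carry \<open>\<sigma> t\<close> through \<open>derived_sigma\<close>.
  Each \<open>\<sigma> t\<close> is thus an automorphism of the derived operation.\<close>

lemma sigma_derived:
  assumes "t \<in> X" "u \<in> X" "x \<in> X"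
  shows "\<sigma> t (D u x) = D (\<sigma> t u) (\<sigma> t x)"
proof -
  obtain y where y: "y \<in> X" "u = \<sigma> x y" using sigma_surjE assms by blast
  have "\<sigma> t u = \<sigma> (\<sigma> t x) (\<sigma> (\<tau> x t) y)"
    using assms y sigma_sigma[of t x y] by simp
  then have "D (\<sigma> t u) (\<sigma> t x) = \<sigma> (\<sigma> t u) (\<tau> (\<sigma> (\<tau> x t) y) (\<sigma> t x))"
    using assms y derived_sigma[of "\<sigma> t x" "\<sigma> (\<tau> x t) y"] by simp
  also have "\<dots> = \<sigma> (\<sigma> t u) (\<sigma> (\<tau> u t) (\<tau> y x))"
    using assms y tau_sigma[of t x y] by simp
  also have "\<dots> = \<sigma> t (D u x)"
    using assms y sigma_sigma[of t u "\<tau> y x"] derived_sigma[of x y] by simp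
  finally show ?thesis by simp
qed

text \<open>
  If \<open>\<sigma> x z = x\<close>, then \<open>\<tau> z x\<close> is \<open>z \<triangleright> z\<close>, so \<open>z\<close> determines \<open>x\<close>; hence the diagonal map
  \<open>x \<mapsto> \<sigma>\<^sub>x\<^sup>-\<^sup>1(x)\<close> is a permutation.
\<close>

lemma diagonal_unique:
  assumes "z \<in> X" "x \<in> X" "y \<in> X" "\<sigma> x z = x" "\<sigma> y z = y"
  shows "x = y"
proof -
  have "\<tau> z x = D z z" if "x \<in> X" "\<sigma> x z = x" for x
    using derived_sigma[of x z] sigma_derived[of x z z] that assms(1) by (simp add: sigma_inj)
  then show ?thesis
    using assms tau_inj[of z x y] by simp
qed

lemma diagonal_ex:
  assumes "z \<in> X"
  shows "\<exists>x\<in>X. \<sigma> x z = x"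
proof -
  let ?q = "\<lambda>x. inv_into X (\<sigma> x) x"
  have q: "?q x \<in> X \<and> \<sigma> x (?q x) = x" if "x \<in> X" for x
    using sigma_bij[OF that] that
    by (simp add: bij_betw_def f_inv_into_f inv_into_into)
  have "inj_on ?q X"
    by (rule inj_onI) (metis q diagonal_unique)
  then have "?q ` X = X"
    using q fin by (intro endo_inj_surj) auto
  then have "z \<in> ?q ` X" using assms by simp
  then obtain x where "x \<in> X" "z = ?q x" by (rule imageE)
  then show ?thesis using q[of x] by auto
qed

section \<open>The structure group, its universal property and its action on
  \<open>X\<close>\<close>

abbreviation G where "G \<equiv> structure_group X r"
abbreviation \<iota> where "\<iota> \<equiv> structure_map X r"

sublocale G: group G
  unfolding structure_group_def by (rule group_presented_group)

lemma iota_closed [simp]: "x \<in> X \<Longrightarrow> \<iota> x \<in> carrier G"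
  by (auto simp: structure_group_def structure_map_def presented_group_def)

lemma generate_iota: "carrier G = generate G (\<iota> ` X)"
  using presented_group_generate unfolding structure_group_def structure_map_def by blast

lemma iota_relation:
  assumes "x \<in> X" "y \<in> X"
  shows "\<iota> x \<otimes>\<^bsub>G\<^esub> \<iota> y = \<iota> (\<sigma> x y) \<otimes>\<^bsub>G\<^esub> \<iota> (\<tau> y x)"
proof -
  have "word_eq X (structure_relations X r)
      ([] @ [(True, x), (True, y)] @ []) ([] @ [(True, \<sigma> x y), (True, \<tau> y x)] @ [])"
    using assms by (intro word_eq.rel) (auto simp: structure_relations_def)
  then show ?thesis
    using assms by (simp add: structure_group_def structure_map_def presented_group_mult
        word_class_eq_iff)
qed

lemma structure_group_universal:
  assumes "group H" and f: "\<And>x. x \<in> X \<Longrightarrow> f x \<in> carrier H"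
    and rel: "\<And>x y. x \<in> X \<Longrightarrow> y \<in> X \<Longrightarrow> f x \<otimes>\<^bsub>H\<^esub> f y = f (\<sigma> x y) \<otimes>\<^bsub>H\<^esub> f (\<tau> y x)"
  shows "\<exists>h \<in> hom G H. \<forall>x\<in>X. h (\<iota> x) = f x"
proof -
  interpret H: group H by fact
  have "\<exists>h \<in> hom (presented_group X (structure_relations X r)) H.
      \<forall>x\<in>X. h (word_class X (structure_relations X r) [(True, x)]) = f x"
  proof (rule H.presented_group_universal)
    show "f \<in> X \<rightarrow> carrier H" using f by blast
  next
    fix p q assume "(p, q) \<in> structure_relations X r"
    then obtain x y where "x \<in> X" "y \<in> X" "p = [(True, x), (True, y)]"
      "q = [(True, \<sigma> x y), (True, \<tau> y x)]"
      by (auto simp: structure_relations_def)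
    then show "word_eval H f p = word_eval H f q"
      using rel[of x y] f by simp
  qed
  then show ?thesis
    by (simp add: structure_group_def structure_map_def)
qed

text \<open>The inverse case descends from \<open>a \<otimes> \<iota> x\<close> to \<open>a\<close>,
  so an application only describes right multiplication by a generator and then cancels.\<close>

lemma structure_group_induct [consumes 1, case_names one mult mult_inv]:
  assumes "a \<in> carrier G" and "P \<one>\<^bsub>G\<^esub>"
    and "\<And>a x. a \<in> carrier G \<Longrightarrow> x \<in> X \<Longrightarrow> P a \<Longrightarrow> P (a \<otimes>\<^bsub>G\<^esub> \<iota> x)"
    and "\<And>a x. a \<in> carrier G \<Longrightarrow> x \<in> X \<Longrightarrow> P (a \<otimes>\<^bsub>G\<^esub> \<iota> x) \<Longrightarrow> P a"
  shows "P a"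
proof -
  have "a \<in> generate G (\<iota> ` X)" using assms(1) generate_iota by simp
  moreover have "\<iota> ` X \<subseteq> carrier G" by auto
  ultimately show ?thesis
  proof (induction rule: G.generate_right_induct)
    case one
    then show ?case using assms by simp
  next
    case (mult a s)
    then show ?case using assms(3) generate_iota by auto
  next
    case (mult_inv a s)
    then obtain x where x: "x \<in> X" "s = \<iota> x" by blast
    have a: "a \<in> carrier G" using mult_inv generate_iota by simp
    then have "a \<otimes>\<^bsub>G\<^esub> inv\<^bsub>G\<^esub> s \<otimes>\<^bsub>G\<^esub> \<iota> x = a"
      using x by (simp add: G.m_assoc)
    then show ?case using assms(4)[of "a \<otimes>\<^bsub>G\<^esub> inv\<^bsub>G\<^esub> s" x] mult_inv x a by simp
  qed
qed

text \<open>The extension of \<sigma> to an action of the structure group on \<open>X\<close>; it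
  exists because \<open>sigma_sigma\<close> respects the defining relations. In every compatible
  brace it gives \<lambda> on generators (\<open>L_iota\<close>).\<close>

definition lam :: "'a word set \<Rightarrow> 'a \<Rightarrow> 'a"
  where "lam = (SOME h. h \<in> hom G (BijGroup X) \<and> (\<forall>x\<in>X. h (\<iota> x) = restrict (\<sigma> x) X))"

lemma lam_hom: "lam \<in> hom G (BijGroup X)"
  and lam_iota': "x \<in> X \<Longrightarrow> lam (\<iota> x) = restrict (\<sigma> x) X"
proof -
  have B: "restrict (\<sigma> x) X \<in> Bij X" if "x \<in> X" for x
    using restrict_Bij sigma_bij[OF that] by blast
  have "\<exists>h \<in> hom G (BijGroup X). \<forall>x\<in>X. h (\<iota> x) = restrict (\<sigma> x) X"
  proof (rule structure_group_universal[OF group_BijGroup])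
    fix x y assume xy: "x \<in> X" "y \<in> X"
    show "restrict (\<sigma> x) X \<otimes>\<^bsub>BijGroup X\<^esub> restrict (\<sigma> y) X =
        restrict (\<sigma> (\<sigma> x y)) X \<otimes>\<^bsub>BijGroup X\<^esub> restrict (\<sigma> (\<tau> y x)) X"
      using xy by (intro Bij_eqI[of _ X] BijGroup_mult_Bij B)
        (simp_all add: B BijGroup_mult_apply sigma_sigma[of x y])
  qed (use B in \<open>simp add: carrier_BijGroup\<close>)
  then have "lam \<in> hom G (BijGroup X) \<and> (\<forall>x\<in>X. lam (\<iota> x) = restrict (\<sigma> x) X)"
    unfolding lam_def Bex_def by (rule someI_ex)
  then show "lam \<in> hom G (BijGroup X)" and "x \<in> X \<Longrightarrow> lam (\<iota> x) = restrict (\<sigma> x) X"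
    by blast+
qed

lemma lam_iota [simp]: "x \<in> X \<Longrightarrow> y \<in> X \<Longrightarrow> lam (\<iota> x) y = \<sigma> x y"
  by (simp add: lam_iota')

lemma lam_Bij: "a \<in> carrier G \<Longrightarrow> lam a \<in> Bij X"
  using hom_in_carrier[OF lam_hom] by (simp add: carrier_BijGroup)

lemma lam_closed [simp]: "a \<in> carrier G \<Longrightarrow> x \<in> X \<Longrightarrow> lam a x \<in> X"
  by (rule Bij_closed[OF lam_Bij])

lemma lam_mult: "a \<in> carrier G \<Longrightarrow> b \<in> carrier G \<Longrightarrow> x \<in> X \<Longrightarrow> lam (a \<otimes>\<^bsub>G\<^esub> b) x = lam a (lam b x)"
  using hom_mult[OF lam_hom, of a b] lam_Bij by (simp add: BijGroup_mult_apply)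

lemma lam_one [simp]: "x \<in> X \<Longrightarrow> lam \<one>\<^bsub>G\<^esub> x = x"
  using hom_one[OF lam_hom G.is_group group_BijGroup] by (simp add: BijGroup_one_apply)

lemma lam_inv [simp]:
  assumes "a \<in> carrier G" "x \<in> X"
  shows "lam a (lam (inv\<^bsub>G\<^esub> a) x) = x" "lam (inv\<^bsub>G\<^esub> a) (lam a x) = x"
  using assms lam_mult[of a "inv\<^bsub>G\<^esub> a" x] lam_mult[of "inv\<^bsub>G\<^esub> a" a x] by simp_all

lemma lam_derived:
  assumes "a \<in> carrier G" "u \<in> X" "x \<in> X"
  shows "lam a (D u x) = D (lam a u) (lam a x)"
  using assms
proof (induction arbitrary: u x rule: structure_group_induct)
  case (mult a t)
  then show ?case by (simp add: lam_mult sigma_derived)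
next
  case (mult_inv a t)
  \<comment> \<open>The hypothesis concerns \<open>a \<otimes> \<iota> t\<close>, so
    \<open>u\<close> and \<open>x\<close> are pulled back along the surjection
    \<open>\<sigma> t\<close>.\<close>
  obtain v where "v \<in> X" "u = \<sigma> t v" using sigma_surjE mult_inv.hyps mult_inv.prems by blast
  moreover obtain y where "y \<in> X" "x = \<sigma> t y" using sigma_surjE mult_inv.hyps mult_inv.prems by blast
  ultimately show ?case
    using mult_inv.IH[of v y] mult_inv.hyps by (simp add: lam_mult sigma_derived)
qed simp

section \<open>The skew brace structure on the structure group\<close>

text \<open>\<open>T x\<close> is going to be the right translation \<open>a \<mapsto> a + \<iota> x\<close> of the additive group.\<close>

definition T :: "'a \<Rightarrow> 'a word set \<Rightarrow> 'a word set"
  where "T x a = a \<otimes>\<^bsub>G\<^esub> \<iota> (lam (inv\<^bsub>G\<^esub> a) x)"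

lemma T_closed [simp]: "a \<in> carrier G \<Longrightarrow> x \<in> X \<Longrightarrow> T x a \<in> carrier G"
  by (simp add: T_def)

lemma T_lam: "a \<in> carrier G \<Longrightarrow> y \<in> X \<Longrightarrow> T (lam a y) a = a \<otimes>\<^bsub>G\<^esub> \<iota> y"
  by (simp add: T_def)

text \<open>In the inner index the inverse of \<open>g \<otimes> a\<close> undoes
  \<open>lam g\<close>, which leaves the index occurring in \<open>T x a\<close>.\<close>

lemma T_translate:
  "g \<in> carrier G \<Longrightarrow> a \<in> carrier G \<Longrightarrow> x \<in> X \<Longrightarrow>
    T (lam g x) (g \<otimes>\<^bsub>G\<^esub> a) = g \<otimes>\<^bsub>G\<^esub> T x a"
  by (simp add: T_def G.inv_mult_group lam_mult G.m_assoc)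

text \<open>At the unit, with \<open>u = \<sigma> x y\<close>, these are the two sides of a defining
  relation. \<open>T_translate\<close> carries the identity to \<open>a\<close>, and
  \<open>lam_derived\<close> matches the index \<open>D u x\<close>.\<close>

lemma T_conj:
  assumes "a \<in> carrier G" "x \<in> X" "u \<in> X"
  shows "T u (T x a) = T (D u x) (T u a)"
proof -
  have at_one: "T u (T x \<one>\<^bsub>G\<^esub>) = T (D u x) (T u \<one>\<^bsub>G\<^esub>)" if "x \<in> X" "u \<in> X" for x u
  proof -
    have T1: "T z \<one>\<^bsub>G\<^esub> = \<iota> z" if "z \<in> X" for z
      using that by (simp add: T_def)
    obtain y where y: "y \<in> X" "u = \<sigma> x y" using sigma_surjE \<open>x \<in> X\<close> \<open>u \<in> X\<close> by blast
    have "T u (\<iota> x) = \<iota> x \<otimes>\<^bsub>G\<^esub> \<iota> y"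
      using T_lam[of "\<iota> x" y] y \<open>x \<in> X\<close> by simp
    moreover have "T (D u x) (\<iota> u) = \<iota> u \<otimes>\<^bsub>G\<^esub> \<iota> (\<tau> y x)"
      using T_lam[of "\<iota> u" "\<tau> y x"] derived_sigma[of x y] y \<open>x \<in> X\<close> by simp
    ultimately show ?thesis
      using iota_relation[of x y] y T1 that by simp
  qed
  let ?x = "lam (inv\<^bsub>G\<^esub> a) x" and ?u = "lam (inv\<^bsub>G\<^esub> a) u"
  have xu: "?x \<in> X" "?u \<in> X" "lam a ?x = x" "lam a ?u = u" "lam a (D ?u ?x) = D u x"
    using assms by (simp_all add: lam_derived)
  have tr: "T (lam a z) (a \<otimes>\<^bsub>G\<^esub> b) = a \<otimes>\<^bsub>G\<^esub> T z b" if "z \<in> X" "b \<in> carrier G" for z b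
    using T_translate that assms by simp
  have "T u (T x a) = T (lam a ?u) (T (lam a ?x) (a \<otimes>\<^bsub>G\<^esub> \<one>\<^bsub>G\<^esub>))"
    using xu assms by simp
  also have "\<dots> = a \<otimes>\<^bsub>G\<^esub> T ?u (T ?x \<one>\<^bsub>G\<^esub>)"
    by (simp only: tr[OF xu(1) G.one_closed] tr[OF xu(2) T_closed[OF G.one_closed xu(1)]])
  also have "\<dots> = a \<otimes>\<^bsub>G\<^esub> T (D ?u ?x) (T ?u \<one>\<^bsub>G\<^esub>)"
    using at_one[OF xu(1,2)] by simp
  also have "\<dots> = T (lam a (D ?u ?x)) (T (lam a ?u) (a \<otimes>\<^bsub>G\<^esub> \<one>\<^bsub>G\<^esub>))"
    by (simp only: tr[OF xu(2) G.one_closed]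
        tr[OF derived_closed[OF xu(2,1)] T_closed[OF G.one_closed xu(2)]])
  also have "\<dots> = T (D u x) (T u a)"
    using xu assms by simp
  finally show ?thesis .
qed

text \<open>For \<open>y = lam (inv a) x\<close> one has
  \<open>T x a = a \<otimes> \<iota> y\<close>, and \<open>\<sigma> y\<close> sends
  \<open>lam (inv (T x a)) x\<close> to \<open>y\<close>. By \<open>diagonal_unique\<close> the
  value determines \<open>y\<close> and then \<open>a\<close>; \<open>diagonal_ex\<close> provides
  the \<open>y\<close> that yields a preimage.\<close>

lemma T_bij:
  assumes x: "x \<in> X"
  shows "bij_betw (T x) (carrier G) (carrier G)"
  unfolding bij_betw_def
proof
  have diag: "\<sigma> (lam (inv\<^bsub>G\<^esub> a) x) (lam (inv\<^bsub>G\<^esub> (T x a)) x) = lam (inv\<^bsub>G\<^esub> a) x"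
    if "a \<in> carrier G" for a
  proof -
    let ?y = "lam (inv\<^bsub>G\<^esub> a) x"
    have "lam (inv\<^bsub>G\<^esub> (T x a)) x = lam (inv\<^bsub>G\<^esub> (\<iota> ?y)) ?y"
      using that x by (simp add: T_def G.inv_mult_group lam_mult)
    moreover have "\<sigma> ?y (lam (inv\<^bsub>G\<^esub> (\<iota> ?y)) ?y) = ?y"
      using that x lam_inv(1)[of "\<iota> ?y" ?y] by (simp del: lam_inv)
    ultimately show ?thesis by simp
  qed
  show "inj_on (T x) (carrier G)"
  proof (rule inj_onI)
    fix a b assume ab: "a \<in> carrier G" "b \<in> carrier G" and eq: "T x a = T x b"
    have "lam (inv\<^bsub>G\<^esub> a) x = lam (inv\<^bsub>G\<^esub> b) x"
      using diagonal_unique[of "lam (inv\<^bsub>G\<^esub> (T x a)) x"] diag[OF ab(1)] diag[OF ab(2)] eq ab x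
      by simp
    then show "a = b"
      using eq ab x by (simp add: T_def)
  qed
  show "T x ` carrier G = carrier G"
  proof
    show "T x ` carrier G \<subseteq> carrier G" using x by auto
    show "carrier G \<subseteq> T x ` carrier G"
    proof
      fix c assume c: "c \<in> carrier G"
      obtain y where y: "y \<in> X" "\<sigma> y (lam (inv\<^bsub>G\<^esub> c) x) = y"
        using diagonal_ex[of "lam (inv\<^bsub>G\<^esub> c) x"] c x by auto
      have "T x (c \<otimes>\<^bsub>G\<^esub> inv\<^bsub>G\<^esub> (\<iota> y)) = c"
        using c x y by (simp add: T_def G.inv_mult_group lam_mult G.m_assoc)
      then show "c \<in> T x ` carrier G"
        using c y by (intro image_eqI[of _ _ "c \<otimes>\<^bsub>G\<^esub> inv\<^bsub>G\<^esub> (\<iota> y)"]) auto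
    qed
  qed
qed

section \<open>Permutations of the structure group and the cocycle \<pi>\<close>

abbreviation P where "P \<equiv> BijGroup (carrier G)"

sublocale P: group P
  by (rule group_BijGroup)

definition t :: "'a \<Rightarrow> 'a word set \<Rightarrow> 'a word set"
  where "t x = restrict (T x) (carrier G)"

definition l :: "'a word set \<Rightarrow> 'a word set \<Rightarrow> 'a word set"
  where "l g = restrict (\<lambda>a. g \<otimes>\<^bsub>G\<^esub> a) (carrier G)"

lemma t_apply [simp]: "a \<in> carrier G \<Longrightarrow> t x a = T x a"
  and l_apply [simp]: "a \<in> carrier G \<Longrightarrow> l g a = g \<otimes>\<^bsub>G\<^esub> a"
  by (simp_all add: t_def l_def)

lemma t_closed [simp]: "x \<in> X \<Longrightarrow> t x \<in> carrier P"
  unfolding t_def carrier_BijGroup by (intro restrict_Bij T_bij)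

lemma l_closed [simp]:
  assumes "g \<in> carrier G"
  shows "l g \<in> carrier P"
  unfolding l_def carrier_BijGroup
proof (rule restrict_Bij, rule bij_betwI[where g = "\<lambda>a. inv\<^bsub>G\<^esub> g \<otimes>\<^bsub>G\<^esub> a"])
qed (use assms in auto)

lemma P_apply: "f \<in> carrier P \<Longrightarrow> g \<in> carrier P \<Longrightarrow> a \<in> carrier G \<Longrightarrow> (f \<otimes>\<^bsub>P\<^esub> g) a = f (g a)"
  by (simp add: carrier_BijGroup BijGroup_mult_apply)

lemma P_closed: "f \<in> carrier P \<Longrightarrow> a \<in> carrier G \<Longrightarrow> f a \<in> carrier G"
  unfolding carrier_BijGroup by (rule Bij_closed)

lemma P_eqI: "f \<in> carrier P \<Longrightarrow> g \<in> carrier P \<Longrightarrow> (\<And>a. a \<in> carrier G \<Longrightarrow> f a = g a) \<Longrightarrow> f = g"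
  unfolding carrier_BijGroup by (rule Bij_eqI)

lemma P_inj: "f \<in> carrier P \<Longrightarrow> a \<in> carrier G \<Longrightarrow> b \<in> carrier G \<Longrightarrow> f a = f b \<Longrightarrow> a = b"
  by (auto simp: carrier_BijGroup Bij_def bij_betw_def inj_on_def)

lemma l_mult:
  assumes "g \<in> carrier G" "h \<in> carrier G"
  shows "l (g \<otimes>\<^bsub>G\<^esub> h) = l g \<otimes>\<^bsub>P\<^esub> l h"
  using assms by (intro P_eqI) (auto simp: P_apply G.m_assoc)

lemma l_t:
  assumes "g \<in> carrier G" "x \<in> X"
  shows "l g \<otimes>\<^bsub>P\<^esub> t x = t (lam g x) \<otimes>\<^bsub>P\<^esub> l g"
  using assms by (intro P_eqI) (auto simp: P_apply T_translate)

lemma t_t: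
  assumes "u \<in> X" "x \<in> X"
  shows "t u \<otimes>\<^bsub>P\<^esub> t x = t (D u x) \<otimes>\<^bsub>P\<^esub> t u"
  using assms by (intro P_eqI) (auto simp: P_apply T_conj[of _ x u])

definition \<Theta> :: "'a word set \<Rightarrow> 'a word set \<Rightarrow> 'a word set"
  where "\<Theta> = (SOME h. h \<in> hom G P \<and> (\<forall>x\<in>X. h (\<iota> x) = inv\<^bsub>P\<^esub> (t x) \<otimes>\<^bsub>P\<^esub> l (\<iota> x)))"

text \<open>In the skew brace, \<open>\<Theta> g\<close> is the map \<open>a \<mapsto> g \<circ> a - g\<close>.\<close>

lemma Theta_hom: "\<Theta> \<in> hom G P"
  and Theta_iota: "x \<in> X \<Longrightarrow> \<Theta> (\<iota> x) = inv\<^bsub>P\<^esub> (t x) \<otimes>\<^bsub>P\<^esub> l (\<iota> x)"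
proof -
  let ?f = "\<lambda>x. inv\<^bsub>P\<^esub> (t x) \<otimes>\<^bsub>P\<^esub> l (\<iota> x)"
  \<comment> \<open>Moving \<open>l (\<iota> x)\<close> past \<open>inv (t y)\<close> by
    \<open>l_t\<close> separates the translations from the left multiplications.\<close>
  have f_mult: "?f x \<otimes>\<^bsub>P\<^esub> ?f y = inv\<^bsub>P\<^esub> (t (\<sigma> x y) \<otimes>\<^bsub>P\<^esub> t x) \<otimes>\<^bsub>P\<^esub> l (\<iota> x \<otimes>\<^bsub>G\<^esub> \<iota> y)"
    if xy: "x \<in> X" "y \<in> X" for x y
  proof -
    have "t (\<sigma> x y) \<otimes>\<^bsub>P\<^esub> l (\<iota> x) \<otimes>\<^bsub>P\<^esub> inv\<^bsub>P\<^esub> (t y) = l (\<iota> x) \<otimes>\<^bsub>P\<^esub> t y \<otimes>\<^bsub>P\<^esub> inv\<^bsub>P\<^esub> (t y)"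
      using l_t[of "\<iota> x" y] xy by simp
    also have "\<dots> = l (\<iota> x)"
      using xy by (simp add: P.m_assoc)
    finally have "t (\<sigma> x y) \<otimes>\<^bsub>P\<^esub> l (\<iota> x) \<otimes>\<^bsub>P\<^esub> inv\<^bsub>P\<^esub> (t y) = l (\<iota> x)" .
    then have shift: "l (\<iota> x) \<otimes>\<^bsub>P\<^esub> inv\<^bsub>P\<^esub> (t y) = inv\<^bsub>P\<^esub> (t (\<sigma> x y)) \<otimes>\<^bsub>P\<^esub> l (\<iota> x)"
      using xy by (simp add: P.m_assoc P.inv_solve_left)
    have "?f x \<otimes>\<^bsub>P\<^esub> ?f y = inv\<^bsub>P\<^esub> (t x) \<otimes>\<^bsub>P\<^esub> (l (\<iota> x) \<otimes>\<^bsub>P\<^esub> inv\<^bsub>P\<^esub> (t y)) \<otimes>\<^bsub>P\<^esub> l (\<iota> y)"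
      using xy by (simp add: P.m_assoc)
    then show ?thesis
      unfolding shift using xy by (simp add: P.m_assoc P.inv_mult_group l_mult)
  qed
  have "\<exists>h \<in> hom G P. \<forall>x\<in>X. h (\<iota> x) = ?f x"
  proof (rule structure_group_universal[OF group_BijGroup])
    fix x y assume xy: "x \<in> X" "y \<in> X"
    show "?f x \<otimes>\<^bsub>P\<^esub> ?f y = ?f (\<sigma> x y) \<otimes>\<^bsub>P\<^esub> ?f (\<tau> y x)"
      \<comment> \<open>The factors \<open>l\<close> agree by the defining relation, the factors
        \<open>t\<close> by \<open>t_t\<close> at \<open>u = \<sigma> x y\<close>, where
        \<open>D u x = \<sigma> u (\<tau> y x)\<close>.\<close>
      using xy f_mult[of x y] f_mult[of "\<sigma> x y" "\<tau> y x"] iota_relation[of x y]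
        t_t[of "\<sigma> x y" x] derived_sigma[of x y]
      by simp
  qed simp
  then have "\<Theta> \<in> hom G P \<and> (\<forall>x\<in>X. \<Theta> (\<iota> x) = ?f x)"
    unfolding \<Theta>_def Bex_def by (rule someI_ex)
  then show "\<Theta> \<in> hom G P" and "x \<in> X \<Longrightarrow> \<Theta> (\<iota> x) = ?f x"
    by blast+
qed

lemma Theta_closed [simp]: "g \<in> carrier G \<Longrightarrow> \<Theta> g \<in> carrier P"
  using hom_in_carrier[OF Theta_hom] .

text \<open>Right translation by \<open>a\<close>: the element \<open>a \<circ> c - a\<close> goes
  to \<open>c\<close> under the inverse of \<open>\<Theta> a\<close>, and then to
  \<open>a \<circ> c\<close>.\<close>

definition \<pi> :: "'a word set \<Rightarrow> 'a word set \<Rightarrow> 'a word set"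
  where "\<pi> a = l a \<otimes>\<^bsub>P\<^esub> inv\<^bsub>P\<^esub> (\<Theta> a)"

lemma pi_closed [simp]: "a \<in> carrier G \<Longrightarrow> \<pi> a \<in> carrier P"
  by (simp add: \<pi>_def)

lemma pi_apply_closed [simp]: "a \<in> carrier G \<Longrightarrow> b \<in> carrier G \<Longrightarrow> \<pi> b a \<in> carrier G"
  by (simp add: P_closed)

text \<open>The cocycle identity, from multiplicativity of \<open>l\<close> and \<Theta>. It is
  \<open>a \<circ> b = a + \<lambda>\<^sub>a b\<close> in terms of translations, since conjugation
  of \<open>\<pi> b\<close> by \<open>l a\<close> is translation by
  \<open>\<lambda>\<^sub>a b\<close>.\<close>

lemma pi_mult:
  assumes "a \<in> carrier G" "b \<in> carrier G"
  shows "\<pi> (a \<otimes>\<^bsub>G\<^esub> b) = l a \<otimes>\<^bsub>P\<^esub> \<pi> b \<otimes>\<^bsub>P\<^esub> inv\<^bsub>P\<^esub> (l a) \<otimes>\<^bsub>P\<^esub> \<pi> a"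
  using assms hom_mult[OF Theta_hom] by (simp add: \<pi>_def l_mult P.inv_mult_group P.m_assoc)

lemma pi_iota: "x \<in> X \<Longrightarrow> \<pi> (\<iota> x) = t x"
  by (simp add: \<pi>_def Theta_iota P.inv_mult_group)

lemma pi_one: "\<pi> \<one>\<^bsub>G\<^esub> = \<one>\<^bsub>P\<^esub>"
proof -
  have "l \<one>\<^bsub>G\<^esub> = \<one>\<^bsub>P\<^esub>"
    by (intro P_eqI) (auto simp: BijGroup_one_apply)
  then show ?thesis
    using hom_one[OF Theta_hom G.is_group P.is_group] by (simp add: \<pi>_def)
qed

lemma pi_mult_iota:
  assumes "a \<in> carrier G" "x \<in> X"
  shows "\<pi> (a \<otimes>\<^bsub>G\<^esub> \<iota> x) = t (lam a x) \<otimes>\<^bsub>P\<^esub> \<pi> a"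
  using assms pi_mult[of a "\<iota> x"] l_t[of a x] by (simp add: pi_iota P.m_assoc)

lemma pi_T:
  assumes "a \<in> carrier G" "x \<in> X"
  shows "\<pi> (T x a) = t x \<otimes>\<^bsub>P\<^esub> \<pi> a"
  using assms by (simp add: T_def pi_mult_iota)

text \<open>As \<open>a + b\<close> is \<open>\<pi> b a\<close>, this is associativity of the
  addition, built up one generator at a time from \<open>pi_T\<close>.\<close>

lemma pi_pi:
  assumes "b \<in> carrier G" and a: "a \<in> carrier G"
  shows "\<pi> (\<pi> b a) = \<pi> b \<otimes>\<^bsub>P\<^esub> \<pi> a"
  using assms(1)
proof (induction rule: structure_group_induct)
  case one
  then show ?case using a by (simp add: pi_one BijGroup_one_apply)
next
  case (mult b x)
  then show ?case using a by (simp add: pi_mult_iota P_apply pi_T P.m_assoc)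
next
  case (mult_inv b x)
  then have "t (lam b x) \<otimes>\<^bsub>P\<^esub> \<pi> (\<pi> b a) = t (lam b x) \<otimes>\<^bsub>P\<^esub> (\<pi> b \<otimes>\<^bsub>P\<^esub> \<pi> a)"
    using a by (simp add: pi_mult_iota P_apply pi_T P.m_assoc)
  then show ?case
    using mult_inv a by simp
qed

text \<open>Left neutrality of the unit for the new addition; it also recovers \<open>b\<close> from
  \<open>\<pi> b\<close>.\<close>

lemma pi_at_one:
  assumes "b \<in> carrier G"
  shows "\<pi> b \<one>\<^bsub>G\<^esub> = b"
  using assms
proof (induction rule: structure_group_induct)
  case one
  then show ?case by (simp add: pi_one BijGroup_one_apply)
next
  case (mult b x)
  then show ?case by (simp add: pi_mult_iota P_apply T_lam)
next
  case (mult_inv b x)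
  then have "t (lam b x) (\<pi> b \<one>\<^bsub>G\<^esub>) = t (lam b x) b"
    by (simp add: pi_mult_iota P_apply T_lam)
  then show ?case
    using mult_inv P_inj[of "t (lam b x)"] by simp
qed

section \<open>Existence of a compatible skew brace\<close>

definition translation_brace :: "'a word set ring"
  where "translation_brace =
    \<lparr>carrier = carrier G, mult = mult G, one = one G, zero = one G, add = (\<lambda>a b. \<pi> b a)\<rparr>"

lemma translation_brace_sel [simp]:
  "carrier translation_brace = carrier G"
  "mult translation_brace = mult G"
  "one translation_brace = one G"
  "zero translation_brace = one G"
  "a \<oplus>\<^bsub>translation_brace\<^esub> b = \<pi> b a"
  by (simp_all add: translation_brace_def)

lemma group_add_translation_brace: "group (add_monoid translation_brace)"
proof (rule groupI)
  fix a assume a: "a \<in> carrier (add_monoid translation_brace)"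
  \<comment> \<open>A left inverse of \<open>a\<close> is a preimage of the unit under the
    permutation \<open>\<pi> a\<close>.\<close>
  have "\<pi> a ` carrier G = carrier G"
    using a pi_closed[of a] by (simp add: carrier_BijGroup Bij_def bij_betw_def)
  then show "\<exists>b\<in>carrier (add_monoid translation_brace).
      b \<otimes>\<^bsub>add_monoid translation_brace\<^esub> a = \<one>\<^bsub>add_monoid translation_brace\<^esub>"
    using G.one_closed by (auto simp: image_iff) (metis G.one_closed imageE)
qed (simp_all add: pi_pi P_apply pi_at_one)

lemma truncate_translation_brace: "monoid.truncate translation_brace = G"
  by (simp add: translation_brace_def monoid.defs)

lemma group_translation_brace: "group translation_brace"
proof (rule groupI)
  fix a assume "a \<in> carrier translation_brace"
  then show "\<exists>b\<in>carrier translation_brace. b \<otimes>\<^bsub>translation_brace\<^esub> a = \<one>\<^bsub>translation_brace\<^esub>"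
    by (intro bexI[of _ "inv\<^bsub>G\<^esub> a"]) auto
qed (simp_all add: G.m_assoc)

text \<open>The brace law is \<open>pi_mult\<close> evaluated at \<open>d = a \<circ> b - a\<close>:
  here \<open>\<pi> a d = a \<circ> b\<close>, the inverse of \<open>l a\<close> leads to
  \<open>b\<close>, \<open>\<pi> c\<close> to \<open>b + c\<close>, and \<open>l a\<close>
  multiplies by \<open>a\<close>.\<close>

lemma skew_left_brace_translation_brace: "skew_left_brace translation_brace"
  unfolding skew_left_brace_def
proof (intro conjI ballI group_add_translation_brace group_translation_brace)
  fix a b c
  assume "a \<in> carrier translation_brace" "b \<in> carrier translation_brace" "c \<in> carrier translation_brace"
  then have abc [simp]: "a \<in> carrier G" "b \<in> carrier G" "c \<in> carrier G" by auto
  interpret A: group "add_monoid translation_brace" by (rule group_add_translation_brace)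
  define d where "d = (a \<otimes>\<^bsub>G\<^esub> b) \<ominus>\<^bsub>translation_brace\<^esub> a"
  have neg: "\<ominus>\<^bsub>translation_brace\<^esub> a \<in> carrier G"
    using A.inv_closed[of a] by (simp add: a_inv_def)
  have d [simp]: "d \<in> carrier G"
    using neg by (simp add: d_def a_minus_def)
  have "\<pi> a d = a \<otimes>\<^bsub>G\<^esub> b"
    using A.m_assoc[of "a \<otimes>\<^bsub>G\<^esub> b" "\<ominus>\<^bsub>translation_brace\<^esub> a" a] A.l_inv[of a] neg A.r_one[of "a \<otimes>\<^bsub>G\<^esub> b"]
    by (simp add: d_def a_minus_def a_inv_def)
  moreover have "(inv\<^bsub>P\<^esub> (l a)) (a \<otimes>\<^bsub>G\<^esub> b) = b"
  proof -
    have "(inv\<^bsub>P\<^esub> (l a) \<otimes>\<^bsub>P\<^esub> l a) b = b"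
      using P.l_inv[of "l a"] by (simp add: BijGroup_one_apply)
    then show ?thesis by (subst (asm) P_apply) auto
  qed
  ultimately have "\<pi> (a \<otimes>\<^bsub>G\<^esub> c) d = a \<otimes>\<^bsub>G\<^esub> \<pi> c b"
    by (simp add: pi_mult P_apply P_closed)
  then show "a \<otimes>\<^bsub>translation_brace\<^esub> (b \<oplus>\<^bsub>translation_brace\<^esub> c) =
      ((a \<otimes>\<^bsub>translation_brace\<^esub> b) \<ominus>\<^bsub>translation_brace\<^esub> a) \<oplus>\<^bsub>translation_brace\<^esub> (a \<otimes>\<^bsub>translation_brace\<^esub> c)"
    by (simp add: d_def)
qed

text \<open>\<open>T_lam\<close> gives \<open>\<iota> x + \<iota> (\<sigma> x y) = \<iota> x \<circ>
  \<iota> y\<close>, which settles the first coordinate; the second is then the defining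
  relation.\<close>

lemma is_structure_brace_translation_brace: "is_structure_brace X r translation_brace"
  unfolding is_structure_brace_def
proof (intro conjI ballI skew_left_brace_translation_brace truncate_translation_brace)
  fix x y assume xy [simp]: "x \<in> X" "y \<in> X"
  interpret A: group "add_monoid translation_brace" by (rule group_add_translation_brace)
  interpret M: group translation_brace by (rule group_translation_brace)
  have "\<iota> x \<oplus>\<^bsub>translation_brace\<^esub> \<iota> (\<sigma> x y) = \<iota> x \<otimes>\<^bsub>G\<^esub> \<iota> y"
    using T_lam[of "\<iota> x" y] by (simp add: pi_iota)
  then have lambda: "brace_lambda translation_brace (\<iota> x) (\<iota> y) = \<iota> (\<sigma> x y)"
    using A.inv_cancel_simps(2)[of "\<iota> x" "\<iota> (\<sigma> x y)"] by (simp add: brace_lambda_def a_inv_def)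
  have "inv\<^bsub>translation_brace\<^esub> (\<iota> (\<sigma> x y)) \<otimes>\<^bsub>G\<^esub> \<iota> x \<otimes>\<^bsub>G\<^esub> \<iota> y = \<iota> (\<tau> y x)"
    using M.inv_cancel_simps(2)[of "\<iota> (\<sigma> x y)" "\<iota> (\<tau> y x)"] iota_relation[of x y]
      M.inv_closed[of "\<iota> (\<sigma> x y)"] by (simp add: G.m_assoc)
  then show "brace_solution translation_brace (\<iota> x, \<iota> y) = map_prod \<iota> \<iota> (r (x, y))"
    by (simp add: brace_solution_def lambda r_eq)
qed

text \<open>Compatibility is all that is retained of the brace picked by \<open>SOME\<close>, so the
  finiteness argument is carried out for an arbitrary compatible brace.\<close>

theorem is_structure_brace_structure_brace: "is_structure_brace X r (structure_brace X r)"
  unfolding structure_brace_def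
  using is_structure_brace_translation_brace by (rule someI)

end

section \<open>The structure group of a solution with indecomposable derived solution\<close>

context finite_nondegenerate_solution
begin

section \<open>The degree homomorphism and torsion\<close>

definition degree :: "'a word set \<Rightarrow> int"
  where "degree = (SOME h. h \<in> hom G integer_group \<and> (\<forall>x\<in>X. h (\<iota> x) = 1))"

text \<open>Both sides of every defining relation have length two, so the exponent sum is well
  defined.\<close>

lemma degree_hom: "degree \<in> hom G integer_group"
  and degree_iota [simp]: "x \<in> X \<Longrightarrow> degree (\<iota> x) = 1"
proof -
  have "\<exists>h \<in> hom G integer_group. \<forall>x\<in>X. h (\<iota> x) = 1"
    by (rule structure_group_universal) simp_all
  then have "degree \<in> hom G integer_group \<and> (\<forall>x\<in>X. degree (\<iota> x) = 1)"
    unfolding degree_def Bex_def by (rule someI_ex)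
  then show "degree \<in> hom G integer_group" and "x \<in> X \<Longrightarrow> degree (\<iota> x) = 1"
    by blast+
qed

lemma degree_mult [simp]:
  "a \<in> carrier G \<Longrightarrow> b \<in> carrier G \<Longrightarrow> degree (a \<otimes>\<^bsub>G\<^esub> b) = degree a + degree b"
  using hom_mult[OF degree_hom] by simp

lemma degree_one [simp]: "degree \<one>\<^bsub>G\<^esub> = 0"
  using hom_one[OF degree_hom G.is_group group_integer_group] by simp

lemma group_hom_degree: "group_hom G integer_group degree"
  using degree_hom by (simp add: group_hom_def group_hom_axioms_def G.is_group)

lemma degree_inv [simp]: "g \<in> carrier G \<Longrightarrow> degree (inv\<^bsub>G\<^esub> g) = - degree g"
  using group_hom.hom_inv[OF group_hom_degree] by simp

text \<open>The hypothesis makes the degree injective, and the powers of one generator attain every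
  integer.\<close>

lemma iso_integer_group:
  assumes triv: "\<And>g. g \<in> carrier G \<Longrightarrow> degree g = 0 \<Longrightarrow> g = \<one>\<^bsub>G\<^esub>"
  shows "G \<cong> integer_group"
proof -
  obtain x where x: "x \<in> X" using ybe by (auto simp: ybe_solution_def)
  have "bij_betw degree (carrier G) (carrier integer_group)"
    unfolding bij_betw_def
  proof
    show "inj_on degree (carrier G)"
    proof (rule inj_onI)
      fix a b assume ab: "a \<in> carrier G" "b \<in> carrier G" "degree a = degree b"
      then have "degree (a \<otimes>\<^bsub>G\<^esub> inv\<^bsub>G\<^esub> b) = 0"
        by simp
      then show "a = b" using triv[of "a \<otimes>\<^bsub>G\<^esub> inv\<^bsub>G\<^esub> b"] ab
        by (metis G.inv_closed G.inv_equality G.inv_inv G.m_closed)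
    qed
    have "k \<in> degree ` carrier G" for k
    proof
      show "k = degree (\<iota> x [^]\<^bsub>G\<^esub> k)"
        using hom_int_pow[OF degree_hom _ G.is_group group_integer_group, of "\<iota> x" k] x by simp
    qed (use x in simp)
    then show "degree ` carrier G = carrier integer_group" by auto
  qed
  then show ?thesis
    using degree_hom by (auto simp: is_iso_def iso_def)
qed

end

text \<open>The powers of \<open>g\<close> stay in the finite set \<open>K\<close>, so two of them
  coincide and their quotient is trivial.\<close>

lemma (in group) has_torsion_finite_subgroup:
  assumes K: "subgroup K G" "finite K" and g: "g \<in> K" "g \<noteq> \<one>"
  shows "has_torsion G"
proof -
  have gG: "g \<in> carrier G" using K g subgroup.mem_carrier by metis
  have "g [^] n \<in> K" for n :: nat
    using K(1) g(1) by (induction n) (auto intro: subgroup.m_closed subgroup.one_closed)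
  then have "finite (range (\<lambda>n::nat. g [^] n))"
    using K(2) by (meson finite_subset image_subsetI)
  then have "\<not> inj (\<lambda>n::nat. g [^] n)"
    using finite_imageD by blast
  then obtain i j :: nat where ij: "i < j" "g [^] i = g [^] j"
    by (metis (no_types, lifting) injI linorder_neqE_nat)
  have "g [^] i \<otimes> g [^] (j - i) = g [^] (i + (j - i))"
    using gG by (simp only: nat_pow_mult)
  then have "g [^] i \<otimes> g [^] (j - i) = g [^] i \<otimes> \<one>"
    using gG ij by simp
  then have "g [^] (j - i) = \<one>"
    using gG by simp
  then show ?thesis
    unfolding has_torsion_def using g gG ij by (intro bexI[of _ g] conjI exI[of _ "j - i"]) auto
qed

section \<open>Addition, degree and conjugacy in an arbitrary compatible brace\<close>

locale solution_with_brace = finite_nondegenerate_solution +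
  fixes B :: "'a word set ring"
  assumes brace: "is_structure_brace X r B"
begin

definition A :: "'a word set monoid"
  where "A = add_monoid B"

lemma truncate: "monoid.truncate B = G"
  using brace by (simp add: is_structure_brace_def)

lemma carrier_B: "carrier B = carrier G"
  and mult_B: "mult B = mult G"
  unfolding truncate[symmetric] by (simp_all add: monoid.defs)

lemma carrier_A [simp]: "carrier A = carrier G"
  by (simp add: A_def carrier_B)

sublocale A: group A
  using brace by (simp add: is_structure_brace_def skew_left_brace_def A_def)

lemma A_closed [simp]:
  "a \<in> carrier G \<Longrightarrow> b \<in> carrier G \<Longrightarrow> a \<otimes>\<^bsub>A\<^esub> b \<in> carrier G"
  "a \<in> carrier G \<Longrightarrow> inv\<^bsub>A\<^esub> a \<in> carrier G"
  "\<one>\<^bsub>A\<^esub> \<in> carrier G"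
  using A.m_closed A.inv_closed A.one_closed by simp_all

lemma brace_law:
  assumes "a \<in> carrier G" "b \<in> carrier G" "c \<in> carrier G"
  shows "a \<otimes>\<^bsub>G\<^esub> (b \<otimes>\<^bsub>A\<^esub> c) = (a \<otimes>\<^bsub>G\<^esub> b) \<otimes>\<^bsub>A\<^esub> (inv\<^bsub>A\<^esub> a \<otimes>\<^bsub>A\<^esub> (a \<otimes>\<^bsub>G\<^esub> c))"
proof -
  have "a \<otimes>\<^bsub>B\<^esub> (b \<oplus>\<^bsub>B\<^esub> c) = ((a \<otimes>\<^bsub>B\<^esub> b) \<ominus>\<^bsub>B\<^esub> a) \<oplus>\<^bsub>B\<^esub> (a \<otimes>\<^bsub>B\<^esub> c)"
    using brace assms by (simp add: is_structure_brace_def skew_left_brace_def carrier_B)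
  then have "a \<otimes>\<^bsub>G\<^esub> (b \<otimes>\<^bsub>A\<^esub> c) = ((a \<otimes>\<^bsub>G\<^esub> b) \<otimes>\<^bsub>A\<^esub> inv\<^bsub>A\<^esub> a) \<otimes>\<^bsub>A\<^esub> (a \<otimes>\<^bsub>G\<^esub> c)"
    by (simp add: A_def mult_B a_minus_def a_inv_def)
  then show ?thesis
    using assms by (simp add: A.m_assoc)
qed

abbreviation L where "L \<equiv> brace_lambda B"

lemma L_eq: "L a b = inv\<^bsub>A\<^esub> a \<otimes>\<^bsub>A\<^esub> (a \<otimes>\<^bsub>G\<^esub> b)"
  by (simp add: brace_lambda_def A_def mult_B a_inv_def)

text \<open>With all three arguments equal to the multiplicative unit, the brace law makes this unit
  an additive idempotent.\<close>

lemma one_A: "\<one>\<^bsub>A\<^esub> = \<one>\<^bsub>G\<^esub>"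
proof -
  have "\<one>\<^bsub>G\<^esub> \<otimes>\<^bsub>A\<^esub> \<one>\<^bsub>G\<^esub> = \<one>\<^bsub>G\<^esub>"
    using brace_law[of "\<one>\<^bsub>G\<^esub>" "\<one>\<^bsub>G\<^esub>" "\<one>\<^bsub>G\<^esub>"] A.r_one[of "\<one>\<^bsub>G\<^esub>"] A.l_inv[of "\<one>\<^bsub>G\<^esub>"]
    by simp
  then show ?thesis
    using A.l_cancel_one[of "\<one>\<^bsub>G\<^esub>" "\<one>\<^bsub>G\<^esub>"] by simp
qed

lemma L_closed [simp]: "a \<in> carrier G \<Longrightarrow> b \<in> carrier G \<Longrightarrow> L a b \<in> carrier G"
  by (simp add: L_eq)

lemma add_L: "a \<in> carrier G \<Longrightarrow> b \<in> carrier G \<Longrightarrow> a \<otimes>\<^bsub>A\<^esub> L a b = a \<otimes>\<^bsub>G\<^esub> b"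
  by (simp add: L_eq)

lemma L_hom: "a \<in> carrier G \<Longrightarrow> L a \<in> hom A A"
  by (rule homI) (simp_all add: L_eq brace_law A.m_assoc)

lemma L_mult:
  assumes abc: "a \<in> carrier G" "b \<in> carrier G" "c \<in> carrier G"
  shows "L (a \<otimes>\<^bsub>G\<^esub> b) c = L a (L b c)"
proof -
  interpret L: group_hom A A "L a"
    using L_hom[OF abc(1)] by unfold_locales
  have "L a (L b c) = inv\<^bsub>A\<^esub> (L a b) \<otimes>\<^bsub>A\<^esub> L a (b \<otimes>\<^bsub>G\<^esub> c)"
    using abc L_eq[of b c] L.hom_mult[of "inv\<^bsub>A\<^esub> b" "b \<otimes>\<^bsub>G\<^esub> c"] L.hom_inv[of b] by simp
  also have "\<dots> = L (a \<otimes>\<^bsub>G\<^esub> b) c"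
    using abc by (simp add: L_eq A.inv_mult_group A.m_assoc G.m_assoc)
  finally show ?thesis by simp
qed

lemma L_one: "b \<in> carrier G \<Longrightarrow> L \<one>\<^bsub>G\<^esub> b = b"
  using add_L[of "\<one>\<^bsub>G\<^esub>" b] A.l_one[of "L \<one>\<^bsub>G\<^esub> b"] by (simp add: one_A)

lemma L_iota_iota: "x \<in> X \<Longrightarrow> y \<in> X \<Longrightarrow> L (\<iota> x) (\<iota> y) = \<iota> (\<sigma> x y)"
  using brace by (simp add: is_structure_brace_def brace_solution_def r_eq)

text \<open>\<open>L\<close> and \<open>lam\<close> are both multiplicative in \<open>a\<close> and
  agree on generators by compatibility. This fixes the sum of \<open>a\<close> and a generator, as
  recorded in \<open>add_iota_lam\<close>.\<close>

lemma L_iota: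
  assumes "a \<in> carrier G" "y \<in> X"
  shows "L a (\<iota> y) = \<iota> (lam a y)"
  using assms
proof (induction arbitrary: y rule: structure_group_induct)
  case one
  then show ?case by (simp add: L_one)
next
  case (mult a x)
  then show ?case by (simp add: L_mult L_iota_iota lam_mult)
next
  case (mult_inv a x)
  obtain z where "z \<in> X" "y = \<sigma> x z" using sigma_surjE mult_inv.hyps mult_inv.prems by blast
  then show ?case
    using mult_inv.IH[of z] mult_inv.hyps by (simp add: L_mult L_iota_iota lam_mult)
qed

lemma add_iota_lam: "a \<in> carrier G \<Longrightarrow> x \<in> X \<Longrightarrow> a \<otimes>\<^bsub>A\<^esub> \<iota> (lam a x) = a \<otimes>\<^bsub>G\<^esub> \<iota> x"
  using add_L[of a "\<iota> x"] by (simp add: L_iota)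

lemma degree_add_iota:
  assumes "a \<in> carrier G" "x \<in> X"
  shows "degree (a \<otimes>\<^bsub>A\<^esub> \<iota> x) = degree a + 1"
  using add_iota_lam[of a "lam (inv\<^bsub>G\<^esub> a) x"] assms by simp

text \<open>Multiplying \<open>b\<close> by \<open>\<iota> x\<close> amounts to adding
  \<open>\<iota> (lam b x)\<close>, so along the induction both operations raise the degree by
  one.\<close>

lemma degree_add:
  assumes "b \<in> carrier G" "a \<in> carrier G"
  shows "degree (a \<otimes>\<^bsub>A\<^esub> b) = degree a + degree b"
  using assms(1)
proof (induction rule: structure_group_induct)
  case one
  have "a \<otimes>\<^bsub>A\<^esub> \<one>\<^bsub>G\<^esub> = a"
    using assms(2) A.r_one[of a] unfolding one_A by simp
  then show ?case by simp
next
  case (mult b x)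
  then have "a \<otimes>\<^bsub>A\<^esub> (b \<otimes>\<^bsub>G\<^esub> \<iota> x) = (a \<otimes>\<^bsub>A\<^esub> b) \<otimes>\<^bsub>A\<^esub> \<iota> (lam b x)"
    using assms(2) by (simp add: A.m_assoc add_iota_lam)
  then show ?case
    using mult assms(2) by (simp add: degree_add_iota)
next
  case (mult_inv b x)
  then have "a \<otimes>\<^bsub>A\<^esub> (b \<otimes>\<^bsub>G\<^esub> \<iota> x) = (a \<otimes>\<^bsub>A\<^esub> b) \<otimes>\<^bsub>A\<^esub> \<iota> (lam b x)"
    using assms(2) by (simp add: A.m_assoc add_iota_lam)
  then show ?case
    using mult_inv assms(2) by (simp add: degree_add_iota)
qed

lemma degree_hom_A: "degree \<in> hom A integer_group"
  by (rule homI) (simp_all add: degree_add)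

text \<open>Each multiplicative step by a generator is an additive step by another generator, so
  multiplicative generation passes to the additive group.\<close>

lemma generate_A_iota: "carrier A = generate A (\<iota> ` X)"
proof
  have S: "\<iota> ` X \<subseteq> carrier A" by auto
  show "generate A (\<iota> ` X) \<subseteq> carrier A"
    using A.generate_in_carrier[OF S] by blast
  have "a \<in> generate A (\<iota> ` X)" if "a \<in> carrier G" for a
    using that
  proof (induction rule: structure_group_induct)
    case one
    then show ?case using generate.one[of A] one_A by metis
  next
    case (mult a x)
    then show ?case
      using generate.eng[OF mult(3) generate.incl[of "\<iota> (lam a x)"]] by (simp add: add_iota_lam)
  next
    case (mult_inv a x)
    have "a \<otimes>\<^bsub>G\<^esub> \<iota> x \<otimes>\<^bsub>A\<^esub> inv\<^bsub>A\<^esub> (\<iota> (lam a x)) = a"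
      using mult_inv by (simp add: A.m_assoc flip: add_iota_lam)
    then show ?case
      using generate.eng[OF mult_inv(3) generate.inv[of "\<iota> (lam a x)"]] mult_inv by simp
  qed
  then show "carrier A \<subseteq> generate A (\<iota> ` X)" by auto
qed

text \<open>For \<open>u = \<sigma> x y\<close>, rewriting both sides of the defining relation
  additively gives \<open>\<iota> x + \<iota> u = \<iota> u + \<iota> (D u x)\<close>.\<close>

lemma conj_iota:
  assumes "u \<in> X" "x \<in> X"
  shows "inv\<^bsub>A\<^esub> (\<iota> u) \<otimes>\<^bsub>A\<^esub> \<iota> x \<otimes>\<^bsub>A\<^esub> \<iota> u = \<iota> (D u x)"
proof -
  obtain y where y: "y \<in> X" "u = \<sigma> x y" using sigma_surjE assms by blast
  have "\<iota> x \<otimes>\<^bsub>A\<^esub> \<iota> u = \<iota> u \<otimes>\<^bsub>A\<^esub> \<iota> (D u x)"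
    using iota_relation[of x y] add_iota_lam[of "\<iota> x" y] add_iota_lam[of "\<iota> u" "\<tau> y x"]
      derived_sigma[of x y] assms y by simp
  then show ?thesis
    using assms by (simp add: A.m_assoc)
qed

text \<open>Carries orbits on \<open>X\<close> over to additive conjugacy, starting from
  \<open>conj_iota\<close>. Membership in \<open>Bij X\<close> is part of the induction because
  products in \<open>BijGroup\<close> are evaluated pointwise only for bijections.\<close>

lemma conj_generate:
  assumes g: "g \<in> generate (BijGroup X) ((\<lambda>y. restrict (sol_tau (derived_solution X r) y) X) ` X)"
  shows "g \<in> Bij X \<and> (\<forall>x\<in>X. \<exists>h\<in>carrier A. \<iota> (g x) = inv\<^bsub>A\<^esub> h \<otimes>\<^bsub>A\<^esub> \<iota> x \<otimes>\<^bsub>A\<^esub> h)"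
proof -
  interpret BX: group "BijGroup X" by (rule group_BijGroup)
  have tau: "restrict (sol_tau (derived_solution X r) y) X = restrict (D y) X" for y
    by (auto simp: sol_tau_def derived_solution_def)
  have D_Bij: "restrict (D y) X \<in> Bij X" if "y \<in> X" for y
    by (rule restrict_Bij[OF derived_bij[OF that]])
  show ?thesis
    using g
  proof induction
    case one
    show ?case
      using BX.one_closed
      by (auto simp: carrier_BijGroup BijGroup_one_apply intro!: bexI[of _ "\<one>\<^bsub>A\<^esub>"])
  next
    case (incl h)
    then obtain y where y: "y \<in> X" "h = restrict (D y) X" using tau by auto
    have "\<exists>k\<in>carrier A. \<iota> (h x) = inv\<^bsub>A\<^esub> k \<otimes>\<^bsub>A\<^esub> \<iota> x \<otimes>\<^bsub>A\<^esub> k" if "x \<in> X" for x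
      using y that conj_iota[of y x] by (intro bexI[of _ "\<iota> y"]) simp_all
    then show ?case using y D_Bij by blast
  next
    case (inv h)
    then obtain y where y: "y \<in> X" "h = restrict (D y) X" using tau by auto
    have h: "h \<in> carrier (BijGroup X)" using y D_Bij by (simp add: carrier_BijGroup)
    have "\<exists>k\<in>carrier A. \<iota> ((inv\<^bsub>BijGroup X\<^esub> h) x) = inv\<^bsub>A\<^esub> k \<otimes>\<^bsub>A\<^esub> \<iota> x \<otimes>\<^bsub>A\<^esub> k"
      if x: "x \<in> X" for x
    proof -
      let ?w = "(inv\<^bsub>BijGroup X\<^esub> h) x"
      have w: "?w \<in> X"
        using BX.inv_closed[OF h] x unfolding carrier_BijGroup by (rule Bij_closed)
      have "h ?w = (h \<otimes>\<^bsub>BijGroup X\<^esub> inv\<^bsub>BijGroup X\<^esub> h) x"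
        using h BX.inv_closed[OF h] x
        unfolding carrier_BijGroup by (rule BijGroup_mult_apply[symmetric])
      also have "\<dots> = x"
        using BX.r_inv[OF h] x by (simp add: BijGroup_one_apply)
      finally have "D y ?w = x"
        using w y by simp
      then have eq: "\<iota> x = inv\<^bsub>A\<^esub> (\<iota> y) \<otimes>\<^bsub>A\<^esub> \<iota> ?w \<otimes>\<^bsub>A\<^esub> \<iota> y"
        using conj_iota[of y ?w] y w by simp
      have "\<iota> ?w = inv\<^bsub>A\<^esub> (inv\<^bsub>A\<^esub> (\<iota> y)) \<otimes>\<^bsub>A\<^esub> \<iota> x \<otimes>\<^bsub>A\<^esub> inv\<^bsub>A\<^esub> (\<iota> y)"
        unfolding eq using y w by (simp add: A.m_assoc)
      then show ?thesis
        using y by (intro bexI[of _ "inv\<^bsub>A\<^esub> (\<iota> y)"]) simp_all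
    qed
    then show ?case using BX.inv_closed[OF h] by (simp add: carrier_BijGroup)
  next
    case (eng h1 h2)
    have "\<exists>k\<in>carrier A. \<iota> ((h1 \<otimes>\<^bsub>BijGroup X\<^esub> h2) x) = inv\<^bsub>A\<^esub> k \<otimes>\<^bsub>A\<^esub> \<iota> x \<otimes>\<^bsub>A\<^esub> k"
      if x: "x \<in> X" for x
    proof -
      have h2x: "h2 x \<in> X" using eng x Bij_closed by metis
      obtain k2 where k2: "k2 \<in> carrier A" "\<iota> (h2 x) = inv\<^bsub>A\<^esub> k2 \<otimes>\<^bsub>A\<^esub> \<iota> x \<otimes>\<^bsub>A\<^esub> k2"
        using eng x by blast
      obtain k1 where k1: "k1 \<in> carrier A" "\<iota> (h1 (h2 x)) = inv\<^bsub>A\<^esub> k1 \<otimes>\<^bsub>A\<^esub> \<iota> (h2 x) \<otimes>\<^bsub>A\<^esub> k1"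
        using eng h2x by blast
      show ?thesis
        using k1 k2 x eng
        \<comment> \<open>The map \<open>h2\<close> acts first, so its conjugator \<open>k2\<close>
          stands on the left.\<close>
        by (intro bexI[of _ "k2 \<otimes>\<^bsub>A\<^esub> k1"])
          (simp_all add: BijGroup_mult_apply A.inv_mult_group A.m_assoc)
    qed
    then show ?case using eng BijGroup_mult_Bij by blast
  qed
qed

theorem finite_degree_zero:
  assumes indec: "derived_type_indecomposable X (derived_solution X r)"
  shows "finite {g \<in> carrier G. degree g = 0}"
proof -
  have "finite {g \<in> carrier A. degree g = 0}"
  proof (rule A.finite_kernel_degree[of "\<iota> ` X"])
    fix e f assume "e \<in> \<iota> ` X" "f \<in> \<iota> ` X"
    then obtain x z where xz: "x \<in> X" "e = \<iota> x" "z \<in> X" "f = \<iota> z" by blast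
    show "inv\<^bsub>A\<^esub> e \<otimes>\<^bsub>A\<^esub> f \<otimes>\<^bsub>A\<^esub> e \<in> \<iota> ` X"
      using xz by (simp add: conj_iota)
    obtain g where g: "g x = z"
      "g \<in> generate (BijGroup X) ((\<lambda>y. restrict (sol_tau (derived_solution X r) y) X) ` X)"
      using indec xz unfolding derived_type_indecomposable_def by force
    show "\<exists>g\<in>carrier A. f = inv\<^bsub>A\<^esub> g \<otimes>\<^bsub>A\<^esub> e \<otimes>\<^bsub>A\<^esub> g"
      using bspec[OF conjunct2[OF conj_generate[OF g(2)]] xz(1)] unfolding g(1) xz(2,4) .
  next
    show "carrier A = generate A (\<iota> ` X)" by (rule generate_A_iota)
    show "degree \<in> hom A integer_group" by (rule degree_hom_A)
  qed (use fin in auto)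
  then show ?thesis by simp
qed

text \<open>From \<open>a + \<lambda>\<^sub>a b = a \<circ> b\<close> and additivity of the degree
  for both operations, \<lambda> preserves degrees. So every \<open>a * b\<close> lies in the
  kernel, which is an additive subgroup.\<close>

lemma brace_star_square_degree:
  "brace_star_square B \<subseteq> {g \<in> carrier G. degree g = 0}"
proof -
  interpret degree: group_hom A integer_group degree
    using degree_hom_A by (simp add: group_hom_def group_hom_axioms_def A.is_group)
  have deg_L: "degree (L a b) = degree b" if "a \<in> carrier G" "b \<in> carrier G" for a b
    using add_L[OF that] degree_add[of "L a b" a] that by simp
  have "brace_star B a b \<in> kernel A integer_group degree"
    if "a \<in> carrier G" "b \<in> carrier G" for a b
  proof -
    have "brace_star B a b = L a b \<otimes>\<^bsub>A\<^esub> inv\<^bsub>A\<^esub> b"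
      by (simp add: brace_star_def a_minus_def a_inv_def A_def)
    then show ?thesis
      using that degree_add[of "inv\<^bsub>A\<^esub> b" "L a b"] degree.hom_inv[of b] deg_L
      by (simp add: kernel_def)
  qed
  then have "generate A {brace_star B a b | a b. a \<in> carrier B \<and> b \<in> carrier B}
      \<subseteq> kernel A integer_group degree"
    by (intro A.generate_subgroup_incl degree.subgroup_kernel) (auto simp: carrier_B)
  then show ?thesis
    unfolding brace_star_square_def A_def[symmetric] by (auto simp: kernel_def)
qed

end

theorem theorem6p2:
  fixes X :: "'a set" and r :: "'a \<times> 'a \<Rightarrow> 'a \<times> 'a"
  assumes "ybe_solution X r"
    and "finite X"
    and "nondegenerate X r"
    and "derived_type_indecomposable X (derived_solution X r)"
  shows "finite (brace_star_square (structure_brace X r)) \<and>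
    (\<not> structure_group X r \<cong> integer_group \<longrightarrow> has_torsion (structure_group X r))"
proof -
  interpret finite_nondegenerate_solution X r
    using assms by unfold_locales
  interpret solution_with_brace X r "structure_brace X r"
    by unfold_locales (rule is_structure_brace_structure_brace)
  let ?K = "{g \<in> carrier G. degree g = 0}"
  have fin: "finite ?K" using assms(4) by (rule finite_degree_zero)
  interpret degree: group_hom G integer_group degree
    by (rule group_hom_degree)
  \<comment> \<open>The same finite set is now viewed as a multiplicative subgroup; by
    \<open>iso_integer_group\<close> it is non-trivial unless the group is infinite cyclic.\<close>
  have "kernel G integer_group degree = ?K" by (simp add: kernel_def)
  then have "subgroup ?K G" using degree.subgroup_kernel by simp
  then have "has_torsion G" if "\<not> G \<cong> integer_group"
    using that iso_integer_group G.has_torsion_finite_subgroup[OF _ fin] by blast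
  moreover have "finite (brace_star_square (structure_brace X r))"
    using brace_star_square_degree fin by (rule finite_subset)
  ultimately show ?thesis by blast
qed

end
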